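(* Let $k$ be a field, let $(X,r)$ be a finite nondegenerate square-free involutive set-theoretic solution of the Yang–Baxter equation of multipermutation level $2$, let $\mathcal G=\mathcal G(X,r)$ and $V=kX$. View $k[V]$ as an algebra in the braided category of crossed $\mathcal G$-modules, with grading determined by $|x|=\mathcal L_x$ for $x\in X$ and action of $\mathcal G$ extending its permutation action on $X$. Then $\mathcal A(k,X,r)\cong k[V]^{\underline{op}}$ as algebras, where $k[V]^{\underline{op}}$ is the braided-opposite algebra.
   Context: $(X,r)$: $X$ is a nonempty set, $r:X\times X\to X\times X$ a bijection, $r(x,y)=({}^xy,x^y)$, $\mathcal L_x(y)={}^xy$, $\mathcal R_y(x)=x^y$; nondegenerate means all $\mathcal L_x,\mathcal R_x$ are bijective; square-free means $r(x,x)=(x,x)$; solution means $r^{12}r^{23}r^{12}=r^{23}r^{12}r^{23}$ on $X^3$ (with $r^{12}=r\times\mathrm{id}$, $r^{23}=\mathrm{id}\times r$); involutive means $r^2=\mathrm{id}$. Put $x\sim y$ iff $\mathcal L_x=\mathcal L_y$; $\mathrm{Ret}(X,r)$ is $X/\!\sim$ with the induced solution $([x],[y])\mapsto([{}^xy],[x^y])$; multipermutation level $m$ means $m\ge0$ is minimal with $\mathrm{Ret}^m(X,r)$ a one-element set. $\mathcal G(X,r)\le\mathrm{Sym}(X)$ is the group generated by all $\mathcal L_x$; it is abelian in the present case. $\mathcal A(k,X,r)$ is the free associative algebra $k\langle X\rangle$ modulo the relations $xy=zt$ whenever $r(x,y)=(z,t)$. $k[V]$ is the symmetric algebra on $V$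 (commutative polynomials in the variables $x\in X$). A crossed $\mathcal G$-module is a $\mathcal G$-graded vector space with a linear action of $\mathcal G$ such that $|g.v|=g|v|g^{-1}$ for homogeneous $v$; the braiding of the category is $\Psi^D(v\otimes w)=|v|.w\otimes v$ for homogeneous $v$. In $k[V]$ the degree of a monomial is the product of the degrees of its factors, and $\mathcal G$ acts by algebra automorphisms. The braided-opposite algebra $k[V]^{\underline{op}}$ is the vector space $k[V]$ with product $f\bullet g=\cdot\,\Psi^D(f\otimes g)$, $\cdot$ being the original product; that is, $f\bullet g=(|f|.g)\,f$ for homogeneous $f$. *)

theory Defs
  imports
    "HOL-Library.Multiset"
    "HOL-Library.Poly_Mapping"
    "HOL-Algebra.Bij"
    "HOL-Algebra.Elementary_Groups"
    "HOL-Algebra.Module"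
    "HOL-Algebra.QuotRing"
begin

section \<open>Set-theoretic solutions of the Yang--Baxter equation\<close>

text \<open>
  A pair \<open>(X, r)\<close> is given by a carrier set \<open>X\<close> and a function \<open>r\<close> on pairs, of which only
  the values on \<open>X \<times> X\<close> matter.
  The maps \<open>lact X r x\<close> and \<open>ract X r y\<close> are extensional on \<open>X\<close>, so that equality of functions is
  equality of maps on \<open>X\<close> and they are elements of \<^const>\<open>BijGroup\<close> when bijective.
\<close>

definition lact :: "'x set \<Rightarrow> ('x \<times> 'x \<Rightarrow> 'x \<times> 'x) \<Rightarrow> 'x \<Rightarrow> 'x \<Rightarrow> 'x" where
  "lact X r x = (\<lambda>y\<in>X. fst (r (x, y)))"

definition ract :: "'x set \<Rightarrow> ('x \<times> 'x \<Rightarrow> 'x \<times> 'x) \<Rightarrow> 'x \<Rightarrow> 'x \<Rightarrow> 'x" where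
  "ract X r y = (\<lambda>x\<in>X. snd (r (x, y)))"

definition r12 :: "('x \<times> 'x \<Rightarrow> 'x \<times> 'x) \<Rightarrow> 'x \<times> 'x \<times> 'x \<Rightarrow> 'x \<times> 'x \<times> 'x" where
  "r12 r = (\<lambda>(x, y, z). case r (x, y) of (u, v) \<Rightarrow> (u, v, z))"

definition r23 :: "('x \<times> 'x \<Rightarrow> 'x \<times> 'x) \<Rightarrow> 'x \<times> 'x \<times> 'x \<Rightarrow> 'x \<times> 'x \<times> 'x" where
  "r23 r = (\<lambda>(x, y, z). (x, r (y, z)))"

definition ybe_solution :: "'x set \<Rightarrow> ('x \<times> 'x \<Rightarrow> 'x \<times> 'x) \<Rightarrow> bool" where
  "ybe_solution X r \<longleftrightarrow>
     X \<noteq> {} \<and> bij_betw r (X \<times> X) (X \<times> X) \<and>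
     (\<forall>t \<in> X \<times> X \<times> X. r12 r (r23 r (r12 r t)) = r23 r (r12 r (r23 r t)))"

definition nondegenerate :: "'x set \<Rightarrow> ('x \<times> 'x \<Rightarrow> 'x \<times> 'x) \<Rightarrow> bool" where
  "nondegenerate X r \<longleftrightarrow>
     (\<forall>x\<in>X. bij_betw (lact X r x) X X \<and> bij_betw (ract X r x) X X)"

definition square_free :: "'x set \<Rightarrow> ('x \<times> 'x \<Rightarrow> 'x \<times> 'x) \<Rightarrow> bool" where
  "square_free X r \<longleftrightarrow> (\<forall>x\<in>X. r (x, x) = (x, x))"

definition involutive :: "'x set \<Rightarrow> ('x \<times> 'x \<Rightarrow> 'x \<times> 'x) \<Rightarrow> bool" where
  "involutive X r \<longleftrightarrow> (\<forall>p \<in> X \<times> X. r (r p) = p)"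


section \<open>Retraction and multipermutation level\<close>

definition ret_rel :: "'x set \<Rightarrow> ('x \<times> 'x \<Rightarrow> 'x \<times> 'x) \<Rightarrow> ('x \<times> 'x) set" where
  "ret_rel X r = {(x, y). x \<in> X \<and> y \<in> X \<and> lact X r x = lact X r y}"

definition ret_set :: "'x set \<Rightarrow> ('x \<times> 'x \<Rightarrow> 'x \<times> 'x) \<Rightarrow> 'x set set" where
  "ret_set X r = X // ret_rel X r"

text \<open>
  The unions below are unions of a single class whenever the induced map
  \<open>([x], [y]) \<mapsto> ([fst (r (x, y))], [snd (r (x, y))])\<close> is well defined, as it is for
  nondegenerate involutive solutions.
\<close>

definition ret_map ::
  "'x set \<Rightarrow> ('x \<times> 'x \<Rightarrow> 'x \<times> 'x) \<Rightarrow> 'x set \<times> 'x set \<Rightarrow> 'x set \<times> 'x set" where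
  "ret_map X r = (\<lambda>(A, B).
     (\<Union>x\<in>A. \<Union>y\<in>B. ret_rel X r `` {fst (r (x, y))},
      \<Union>x\<in>A. \<Union>y\<in>B. ret_rel X r `` {snd (r (x, y))}))"

text \<open>
  The type of \<open>Ret\<^sup>m(X, r)\<close> depends on \<open>m\<close>, so minimality of \<open>m = 2\<close> is written out.
\<close>

definition multipermutation_level_2 :: "'x set \<Rightarrow> ('x \<times> 'x \<Rightarrow> 'x \<times> 'x) \<Rightarrow> bool" where
  "multipermutation_level_2 X r \<longleftrightarrow>
     \<not> is_singleton X \<and>
     \<not> is_singleton (ret_set X r) \<and>
     is_singleton (ret_set (ret_set X r) (ret_map X r))"

definition perm_group :: "'x set \<Rightarrow> ('x \<times> 'x \<Rightarrow> 'x \<times> 'x) \<Rightarrow> ('x \<Rightarrow> 'x) monoid" where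
  "perm_group X r = subgroup_generated (BijGroup X) (lact X r ` X)"


section \<open>Algebras and their isomorphisms\<close>

text \<open>The locale \<open>algebra\<close> of HOL-Algebra is restricted to commutative algebras.\<close>

locale assoc_algebra = K?: field K + module K A + A?: ring A
  for K (structure) and A (structure) +
  assumes smult_mult_left:
    "\<lbrakk>a \<in> carrier K; x \<in> carrier A; y \<in> carrier A\<rbrakk> \<Longrightarrow>
      (a \<odot>\<^bsub>A\<^esub> x) \<otimes>\<^bsub>A\<^esub> y = a \<odot>\<^bsub>A\<^esub> (x \<otimes>\<^bsub>A\<^esub> y)"
    and smult_mult_right:
    "\<lbrakk>a \<in> carrier K; x \<in> carrier A; y \<in> carrier A\<rbrakk> \<Longrightarrow>
      x \<otimes>\<^bsub>A\<^esub> (a \<odot>\<^bsub>A\<^esub> y) = a \<odot>\<^bsub>A\<^esub> (x \<otimes>\<^bsub>A\<^esub> y)"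

definition algebra_isomorphic ::
  "('k, 'q) ring_scheme \<Rightarrow> ('k, 'a, 'm) module_scheme \<Rightarrow> ('k, 'b, 'n) module_scheme \<Rightarrow> bool" where
  "algebra_isomorphic K A B \<longleftrightarrow>
     (\<exists>\<phi> \<in> ring_iso A B. \<forall>a \<in> carrier K. \<forall>x \<in> carrier A. \<phi> (a \<odot>\<^bsub>A\<^esub> x) = a \<odot>\<^bsub>B\<^esub> \<phi> x)"

definition quotient_algebra ::
  "('k, 'a, 'm) module_scheme \<Rightarrow> 'a set \<Rightarrow> ('k, 'a set) module" where
  "quotient_algebra A I =
     \<lparr>carrier = carrier (A Quot I), mult = mult (A Quot I), one = one (A Quot I),
      zero = zero (A Quot I), add = add (A Quot I),
      smult = (\<lambda>a C. \<Union>x\<in>C. I +>\<^bsub>A\<^esub> (a \<odot>\<^bsub>A\<^esub> x))\<rparr>"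

definition field_ring :: "'k::field ring" where
  "field_ring = \<lparr>carrier = UNIV, mult = (*), one = 1, zero = 0, add = (+)\<rparr>"

text \<open>
  The algebra over \<open>'k\<close> of a submonoid \<open>S\<close> of an additively written monoid: the type
  \<open>'m \<Rightarrow>\<^sub>0 'k\<close> carries the convolution product, for which
  \<open>single u a * single v b = single (u + v) (a * b)\<close>.
\<close>

definition monoid_algebra :: "'m::monoid_add set \<Rightarrow> ('k::field, 'm \<Rightarrow>\<^sub>0 'k) module" where
  "monoid_algebra S =
     \<lparr>carrier = {f. Poly_Mapping.keys f \<subseteq> S}, mult = (*), one = 1, zero = 0, add = (+),
      smult = (\<lambda>a. Poly_Mapping.map ((*) a))\<rparr>"


section \<open>The quadratic algebra of a solution\<close>

text \<open>Words under concatenation, written additively only to match the convention above.\<close>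

datatype 'x fword = Word (letters: "'x list")

instantiation fword :: (type) monoid_add
begin

definition zero_fword :: "'x fword" where
  "zero_fword = Word []"

definition plus_fword :: "'x fword \<Rightarrow> 'x fword \<Rightarrow> 'x fword" where
  "plus_fword u v = Word (letters u @ letters v)"

instance
  by standard (simp_all add: zero_fword_def plus_fword_def)

end

definition free_algebra :: "'x set \<Rightarrow> ('k::field, 'x fword \<Rightarrow>\<^sub>0 'k) module" where
  "free_algebra X = monoid_algebra {w. set (letters w) \<subseteq> X}"

definition free_var :: "'x \<Rightarrow> ('x fword \<Rightarrow>\<^sub>0 'k::field)" where
  "free_var x = Poly_Mapping.single (Word [x]) 1"

definition quad_relators :: "'x set \<Rightarrow> ('x \<times> 'x \<Rightarrow> 'x \<times> 'x) \<Rightarrow> ('x fword \<Rightarrow>\<^sub>0 'k::field) set" where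
  "quad_relators X r =
     {free_var x * free_var y - free_var z * free_var t | x y z t.
        x \<in> X \<and> y \<in> X \<and> r (x, y) = (z, t)}"

definition quad_algebra ::
  "'x set \<Rightarrow> ('x \<times> 'x \<Rightarrow> 'x \<times> 'x) \<Rightarrow> ('k::field, ('x fword \<Rightarrow>\<^sub>0 'k) set) module" where
  "quad_algebra X r =
     quotient_algebra (free_algebra X) (Idl\<^bsub>free_algebra X\<^esub> (quad_relators X r))"


section \<open>Algebras in the category of crossed modules\<close>

text \<open>
  A grading of \<open>M\<close> by \<open>G\<close> is a family \<open>V\<close> of subspaces, \<open>V g\<close> being the subspace of homogeneous
  elements of degree \<open>g\<close>.  The predicate below says that \<open>u\<close> is the finitely supported family of
  homogeneous components of \<open>f\<close>, extended by zero outside \<open>carrier G\<close>.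
\<close>

definition is_decomposition ::
  "('g, 'p) monoid_scheme \<Rightarrow> ('k, 'a, 'm) module_scheme \<Rightarrow> ('g \<Rightarrow> 'a set) \<Rightarrow> 'a \<Rightarrow> ('g \<Rightarrow> 'a) \<Rightarrow> bool"
  where
  "is_decomposition G M V f u \<longleftrightarrow>
     (\<forall>g \<in> carrier G. u g \<in> V g) \<and> (\<forall>g. g \<notin> carrier G \<longrightarrow> u g = \<zero>\<^bsub>M\<^esub>) \<and>
     finite {g. u g \<noteq> \<zero>\<^bsub>M\<^esub>} \<and> f = (\<Oplus>\<^bsub>M\<^esub>g\<in>{g. u g \<noteq> \<zero>\<^bsub>M\<^esub>}. u g)"

definition components ::
  "('g, 'p) monoid_scheme \<Rightarrow> ('k, 'a, 'm) module_scheme \<Rightarrow> ('g \<Rightarrow> 'a set) \<Rightarrow> 'a \<Rightarrow> 'g \<Rightarrow> 'a" where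
  "components G M V f = (THE u. is_decomposition G M V f u)"

locale crossed_module = K?: field K + G?: group G + module K M
  for K (structure) and G (structure) and M (structure) +
  fixes V :: "'g \<Rightarrow> 'a set" and act :: "'g \<Rightarrow> 'a \<Rightarrow> 'a"
  assumes V_subspace: "g \<in> carrier G \<Longrightarrow> submodule (V g) K M"
    and V_direct_sum: "f \<in> carrier M \<Longrightarrow> \<exists>!u. is_decomposition G M V f u"
    and act_closed: "\<lbrakk>g \<in> carrier G; v \<in> carrier M\<rbrakk> \<Longrightarrow> act g v \<in> carrier M"
    and act_add: "\<lbrakk>g \<in> carrier G; v \<in> carrier M; w \<in> carrier M\<rbrakk> \<Longrightarrow>
      act g (v \<oplus>\<^bsub>M\<^esub> w) = act g v \<oplus>\<^bsub>M\<^esub> act g w"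
    and act_smult: "\<lbrakk>g \<in> carrier G; a \<in> carrier K; v \<in> carrier M\<rbrakk> \<Longrightarrow>
      act g (a \<odot>\<^bsub>M\<^esub> v) = a \<odot>\<^bsub>M\<^esub> act g v"
    and act_one: "v \<in> carrier M \<Longrightarrow> act \<one>\<^bsub>G\<^esub> v = v"
    and act_mult: "\<lbrakk>g \<in> carrier G; h \<in> carrier G; v \<in> carrier M\<rbrakk> \<Longrightarrow>
      act (g \<otimes>\<^bsub>G\<^esub> h) v = act g (act h v)"
    and crossed: "\<lbrakk>g \<in> carrier G; h \<in> carrier G; v \<in> V h\<rbrakk> \<Longrightarrow>
      act g v \<in> V (g \<otimes>\<^bsub>G\<^esub> h \<otimes>\<^bsub>G\<^esub> inv\<^bsub>G\<^esub> g)"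

text \<open>
  An algebra in the category: multiplication and unit respect the grading (with the base field in
  degree \<open>\<one>\<close>) and the action (which is trivial on the base field).
\<close>

locale crossed_module_algebra = crossed_module K G A V act + assoc_algebra K A
  for K (structure) and G (structure) and A (structure) and V and act +
  assumes mult_graded: "\<lbrakk>g \<in> carrier G; h \<in> carrier G; x \<in> V g; y \<in> V h\<rbrakk> \<Longrightarrow>
      x \<otimes>\<^bsub>A\<^esub> y \<in> V (g \<otimes>\<^bsub>G\<^esub> h)"
    and one_graded: "\<one>\<^bsub>A\<^esub> \<in> V \<one>\<^bsub>G\<^esub>"
    and act_prod: "\<lbrakk>g \<in> carrier G; x \<in> carrier A; y \<in> carrier A\<rbrakk> \<Longrightarrow>
      act g (x \<otimes>\<^bsub>A\<^esub> y) = act g x \<otimes>\<^bsub>A\<^esub> act g y"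
    and act_unit: "g \<in> carrier G \<Longrightarrow> act g \<one>\<^bsub>A\<^esub> = \<one>\<^bsub>A\<^esub>"

text \<open>
  The product of the braiding \<open>v \<otimes> w \<mapsto> |v|.w \<otimes> v\<close> followed by the original multiplication.
  For arbitrary \<open>f\<close> with homogeneous components \<open>f\<^sub>h\<close> this is the sum of the \<open>(h.g) f\<^sub>h\<close>.
\<close>

definition braided_op ::
  "('h, 'p) monoid_scheme \<Rightarrow> ('k, 'a, 'm) module_scheme \<Rightarrow> ('h \<Rightarrow> 'a set) \<Rightarrow> ('h \<Rightarrow> 'a \<Rightarrow> 'a) \<Rightarrow>
     ('k, 'a, 'm) module_scheme" where
  "braided_op G A V act =
     A\<lparr>mult := (\<lambda>f g. let u = components G A V f in
        \<Oplus>\<^bsub>A\<^esub>h\<in>{h. u h \<noteq> \<zero>\<^bsub>A\<^esub>}. act h g \<otimes>\<^bsub>A\<^esub> u h)\<rparr>"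


section \<open>The symmetric algebra as a crossed module algebra\<close>

text \<open>Commutative monomials in \<open>X\<close> are multisets, whose addition is multiplication of monomials.\<close>

definition sym_algebra :: "'x set \<Rightarrow> ('k::field, 'x multiset \<Rightarrow>\<^sub>0 'k) module" where
  "sym_algebra X = monoid_algebra {m. set_mset m \<subseteq> X}"

text \<open>
  The product of the degrees \<open>lact X r x\<close> of the factors of a monomial.  The operator
  \<^const>\<open>finprod\<close> is only meaningful in commutative groups; for square-free solutions of
  multipermutation level 2 the group \<open>perm_group X r\<close> is one.
\<close>

definition mon_degree :: "'x set \<Rightarrow> ('x \<times> 'x \<Rightarrow> 'x \<times> 'x) \<Rightarrow> 'x multiset \<Rightarrow> 'x \<Rightarrow> 'x" where
  "mon_degree X r m =
     (\<Otimes>\<^bsub>perm_group X r\<^esub>x\<in>set_mset m. lact X r x [^]\<^bsub>perm_group X r\<^esub> count m x)"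

definition sym_homogeneous ::
  "'x set \<Rightarrow> ('x \<times> 'x \<Rightarrow> 'x \<times> 'x) \<Rightarrow> ('x \<Rightarrow> 'x) \<Rightarrow> ('x multiset \<Rightarrow>\<^sub>0 'k::field) set" where
  "sym_homogeneous X r g =
     {f \<in> carrier (sym_algebra X). \<forall>m \<in> Poly_Mapping.keys f. mon_degree X r m = g}"

text \<open>The substitution of \<open>g x\<close> for every variable \<open>x\<close>.\<close>

definition sym_act :: "('x \<Rightarrow> 'x) \<Rightarrow> ('x multiset \<Rightarrow>\<^sub>0 'k::field) \<Rightarrow> ('x multiset \<Rightarrow>\<^sub>0 'k)" where
  "sym_act g f =
     (\<Sum>m\<in>Poly_Mapping.keys f. Poly_Mapping.single (image_mset g m) (Poly_Mapping.lookup f m))"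

end

theory Submission
  imports Defs
begin

text \<open>
  Square-freeness and multipermutation level 2 make every solution very rigid: all points of the
  retraction act on it in the same way, hence trivially by square-freeness, which says
  \<open>\<L>\<^bsub>\<L>\<^sub>x y\<^esub> = \<L>\<^sub>y\<close> (\<open>lact_invariant_of_level_2\<close>).  Involutivity then gives
  \<open>r (x, y) = (\<L>\<^sub>x y, \<L>\<^sub>y\<^sup>-\<^sup>1 x)\<close>, and the first component of the Yang--Baxter equation says that
  the \<open>\<L>\<^sub>x\<close> commute (\<open>commuting_solution_of_level_2\<close>).  So \<open>\<G>\<close> is abelian and its action preserves
  the degree of every monomial; these two facts are what makes \<open>k[V]\<close> an algebra in the category
  of crossed \<open>\<G>\<close>-modules.

  In \<open>k[V]\<close> with the opposite product, \<open>x \<bullet> y = (\<L>\<^sub>x y) x\<close>, while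
  \<open>(\<L>\<^sub>x y) \<bullet> (\<L>\<^sub>y\<^sup>-\<^sup>1 x) = (\<L>\<^sub>y \<L>\<^sub>y\<^sup>-\<^sup>1 x) (\<L>\<^sub>x y)\<close> is the same monomial.  Hence \<open>x \<mapsto> x\<close> extends to a
  homomorphism from the free algebra that kills the relations.  It sends the word
  \<open>x\<^sub>1 \<dots> x\<^sub>n\<close> to the monomial with factors \<open>\<L>\<^bsub>x\<^sub>1\<^esub> \<dots> \<L>\<^bsub>x\<^sub>i\<^sub>-\<^sub>1\<^esub> x\<^sub>i\<close>, called \<open>twist\<close> below.

  The point is that the relations generate the whole kernel.  As words go to monomials, it is
  enough that two words with the same monomial are equal modulo the relations
  (\<open>word_equiv_if_twist_eq\<close>).  A relation applied to a word exchanges two neighbouring factors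
  \<open>\<L>\<^bsub>x\<^sub>1\<^esub> \<dots> \<L>\<^bsub>x\<^sub>i\<^sub>-\<^sub>1\<^esub> x\<^sub>i\<close> of its monomial and leaves the others alone, so any factor can be moved
  to the front, and induction on the length applies to the rest.  Every monomial is the monomial of
  some word, so the homomorphism is onto, and the isomorphism theorem for rings finishes the proof.
\<close>

section \<open>Linear extension of maps on monomials\<close>

definition linear_extension :: "('m \<Rightarrow> ('n \<Rightarrow>\<^sub>0 'k)) \<Rightarrow> ('m \<Rightarrow>\<^sub>0 'k::field) \<Rightarrow> ('n \<Rightarrow>\<^sub>0 'k)" where
  "linear_extension \<phi> f =
     (\<Sum>m\<in>Poly_Mapping.keys f. Poly_Mapping.map ((*) (Poly_Mapping.lookup f m)) (\<phi> m))"

lemma lookup_scale [simp]: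
  "Poly_Mapping.lookup (Poly_Mapping.map ((*) c) f) m = c * Poly_Mapping.lookup f m"
  for c :: "'k::field"
  by (simp add: Poly_Mapping.map.rep_eq when_def)

lemma scale_zero [simp]: "Poly_Mapping.map ((*) c) 0 = 0" for c :: "'k::field"
  by (rule poly_mapping_eqI) simp

lemma zero_scale [simp]: "Poly_Mapping.map ((*) 0) f = 0" for f :: "'m \<Rightarrow>\<^sub>0 'k::field"
  by (rule poly_mapping_eqI) simp

lemma scale_add_right:
  "Poly_Mapping.map ((*) c) (f + g) = Poly_Mapping.map ((*) c) f + Poly_Mapping.map ((*) c) g"
  for c :: "'k::field"
  by (rule poly_mapping_eqI) (simp add: lookup_add algebra_simps)

lemma scale_add_left:
  "Poly_Mapping.map ((*) (c + d)) f = Poly_Mapping.map ((*) c) f + Poly_Mapping.map ((*) d) f"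
  for c :: "'k::field"
  by (rule poly_mapping_eqI) (simp add: lookup_add algebra_simps)

lemma scale_scale:
  "Poly_Mapping.map ((*) c) (Poly_Mapping.map ((*) d) f) = Poly_Mapping.map ((*) (c * d)) f"
  for c :: "'k::field"
  by (rule poly_mapping_eqI) simp

lemma scale_one [simp]: "Poly_Mapping.map ((*) 1) f = f" for f :: "'m \<Rightarrow>\<^sub>0 'k::field"
  by (rule poly_mapping_eqI) simp

lemma scale_minus_one: "Poly_Mapping.map ((*) (- 1)) f = - f" for f :: "'m \<Rightarrow>\<^sub>0 'k::field"
  by (rule poly_mapping_eqI) simp

lemma scale_single:
  "Poly_Mapping.map ((*) c) (Poly_Mapping.single m d) = Poly_Mapping.single m (c * d)"
  for c :: "'k::field"
  by (rule poly_mapping_eqI) (simp add: lookup_single when_def)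

lemma scale_sum:
  "Poly_Mapping.map ((*) c) (sum f A) = (\<Sum>i\<in>A. Poly_Mapping.map ((*) c) (f i))"
  for c :: "'k::field"
  by (induction A rule: infinite_finite_induct) (simp_all add: scale_add_right)

lemma scale_mult_left:
  "Poly_Mapping.map ((*) c) f * g = Poly_Mapping.map ((*) c) (f * g)"
  for f :: "'m::monoid_add \<Rightarrow>\<^sub>0 'k::field"
  by (simp add: mult_map_scale_conv_mult mult.assoc)

lemma keys_scale: "Poly_Mapping.keys (Poly_Mapping.map ((*) c) f) \<subseteq> Poly_Mapping.keys f"
  for c :: "'k::field"
  by (auto simp: in_keys_iff)

lemma linear_extension_superset:
  assumes "finite A" "Poly_Mapping.keys f \<subseteq> A"
  shows "linear_extension \<phi> f =
    (\<Sum>m\<in>A. Poly_Mapping.map ((*) (Poly_Mapping.lookup f m)) (\<phi> m))"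
  unfolding linear_extension_def
  using assms by (intro sum.mono_neutral_left) (auto simp: in_keys_iff)

lemma linear_extension_zero [simp]: "linear_extension \<phi> 0 = 0"
  by (simp add: linear_extension_def)

lemma linear_extension_add:
  "linear_extension \<phi> (f + g) = linear_extension \<phi> f + linear_extension \<phi> g"
proof -
  let ?A = "Poly_Mapping.keys f \<union> Poly_Mapping.keys g"
  have "Poly_Mapping.keys (f + g) \<subseteq> ?A" by (rule Poly_Mapping.keys_add)
  then show ?thesis
    by (simp add: linear_extension_superset[of ?A] lookup_add scale_add_left sum.distrib)
qed

lemma linear_extension_diff:
  "linear_extension \<phi> (f - g) = linear_extension \<phi> f - linear_extension \<phi> g"
  using linear_extension_add[of \<phi> "f - g" g] by simp

lemma linear_extension_scale:
  "linear_extension \<phi> (Poly_Mapping.map ((*) c) f) = Poly_Mapping.map ((*) c) (linear_extension \<phi> f)"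
  using keys_scale[of c f]
  by (simp add: linear_extension_superset[of "Poly_Mapping.keys f"] scale_sum scale_scale)

lemma linear_extension_single [simp]:
  "linear_extension \<phi> (Poly_Mapping.single m c) = Poly_Mapping.map ((*) c) (\<phi> m)"
  by (simp add: linear_extension_superset[of "{m}"])

lemma keys_linear_extension:
  assumes "\<And>m. m \<in> Poly_Mapping.keys f \<Longrightarrow> Poly_Mapping.keys (\<phi> m) \<subseteq> S"
  shows "Poly_Mapping.keys (linear_extension \<phi> f) \<subseteq> S"
  unfolding linear_extension_def
  using assms keys_scale Poly_Mapping.keys_sum
  by (smt (verit, ccfv_SIG) UN_iff subset_iff)

lemma sum_single_lookup:
  "f = (\<Sum>m\<in>Poly_Mapping.keys f. Poly_Mapping.single m (Poly_Mapping.lookup f m))"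
  by (rule poly_mapping_eqI)
     (simp add: lookup_sum lookup_single when_def in_keys_iff)

text \<open>Reduces identities between expressions additive in \<open>f\<close> to the case of a monomial.\<close>

lemma monomial_induct [consumes 1, case_names zero single add]:
  fixes f :: "'m \<Rightarrow>\<^sub>0 'k::field"
  assumes "Poly_Mapping.keys f \<subseteq> S"
    and "P 0"
    and single: "\<And>m c. m \<in> S \<Longrightarrow> P (Poly_Mapping.single m c)"
    and add: "\<And>f g. \<lbrakk>Poly_Mapping.keys f \<subseteq> S; Poly_Mapping.keys g \<subseteq> S; P f; P g\<rbrakk> \<Longrightarrow> P (f + g)"
  shows "P f"
proof -
  have "Poly_Mapping.keys (\<Sum>m\<in>A. Poly_Mapping.single m (c m)) \<subseteq> S \<and>
        P (\<Sum>m\<in>A. Poly_Mapping.single m (c m))"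
    if "finite A" "A \<subseteq> S" for A and c :: "'m \<Rightarrow> 'k"
    using that
  proof (induction A rule: finite_induct)
    case (insert m A)
    have "Poly_Mapping.keys (Poly_Mapping.single m (c m)) \<subseteq> S"
      using insert.prems by simp
    then show ?case
      using insert Poly_Mapping.keys_add[of "Poly_Mapping.single m (c m)"]
      by (auto intro!: add single)
  qed (simp add: assms(2))
  from this[OF finite_keys assms(1)] show ?thesis
    using sum_single_lookup[of f] by metis
qed


text \<open>Scalars are central although the monoid need not be commutative, since they sit at \<open>0\<close>.\<close>

lemma scale_mult_right:
  "f * Poly_Mapping.map ((*) c) g = Poly_Mapping.map ((*) c) (f * g)"
  for f :: "'m::monoid_add \<Rightarrow>\<^sub>0 'k::field"
proof -
  have "f * Poly_Mapping.single 0 c = Poly_Mapping.single 0 c * f"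
    by (rule monomial_induct[of f UNIV])
       (simp_all add: mult_single distrib_left distrib_right mult.commute)
  then show ?thesis
    by (simp add: mult_map_scale_conv_mult flip: mult.assoc)
qed


section \<open>Monoid algebras\<close>

lemma field_field_ring: "field (field_ring :: 'k::field ring)"
proof -
  have inv: "\<exists>y. x * y = 1" if "x \<noteq> 0" for x :: 'k
    using that right_inverse by blast
  have neg: "\<exists>y. y + x = 0" "\<exists>y. x + y = 0" for x :: 'k
    by (rule exI[of _ "- x"], simp)+
  have "cring (field_ring :: 'k ring)"
    by (rule cringI[OF abelian_groupI comm_monoidI])
       (auto simp: field_ring_def algebra_simps neg)
  then show ?thesis
    by (rule cring.cring_fieldI2) (auto simp: field_ring_def inv)
qed

locale submonoid_algebra =
  fixes S :: "'m::monoid_add set"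
  assumes zero_mem: "0 \<in> S" and add_mem: "\<lbrakk>m \<in> S; n \<in> S\<rbrakk> \<Longrightarrow> m + n \<in> S"
begin

abbreviation "A \<equiv> monoid_algebra S"

lemma operations [simp]:
  "mult A = (*)" "one A = 1" "zero A = 0" "add A = (+)"
  "smult A = (\<lambda>a. Poly_Mapping.map ((*) a))"
  by (simp_all add: monoid_algebra_def)

lemma mem_carrier: "f \<in> carrier A \<longleftrightarrow> Poly_Mapping.keys f \<subseteq> S"
  by (simp add: monoid_algebra_def)

lemma closed:
  shows zero_closed: "0 \<in> carrier A" and one_closed: "1 \<in> carrier A"
    and single_closed: "m \<in> S \<Longrightarrow> Poly_Mapping.single m c \<in> carrier A"
    and add_closed: "\<lbrakk>f \<in> carrier A; g \<in> carrier A\<rbrakk> \<Longrightarrow> f + g \<in> carrier A"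
    and uminus_closed: "f \<in> carrier A \<Longrightarrow> - f \<in> carrier A"
    and mult_closed: "\<lbrakk>f \<in> carrier A; g \<in> carrier A\<rbrakk> \<Longrightarrow> f * g \<in> carrier A"
    and scale_closed: "f \<in> carrier A \<Longrightarrow> Poly_Mapping.map ((*) c) f \<in> carrier A"
proof -
  show "f * g \<in> carrier A" if "f \<in> carrier A" "g \<in> carrier A"
    using that Poly_Mapping.keys_mult[of f g] add_mem unfolding mem_carrier by blast
  show "Poly_Mapping.map ((*) c) f \<in> carrier A" if "f \<in> carrier A"
    using that keys_scale[of c f] unfolding mem_carrier by blast
  show "f + g \<in> carrier A" if "f \<in> carrier A" "g \<in> carrier A"
    using that Poly_Mapping.keys_add[of f g] unfolding mem_carrier by blast
  show "- f \<in> carrier A" if "f \<in> carrier A"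
    using that by (simp add: mem_carrier subset_iff in_keys_iff)
qed (use zero_mem in \<open>simp_all add: mem_carrier\<close>)

lemma abelian_group: "abelian_group A"
proof (rule abelian_groupI)
  fix f assume "f \<in> carrier A"
  then show "\<exists>g\<in>carrier A. g \<oplus>\<^bsub>A\<^esub> f = \<zero>\<^bsub>A\<^esub>"
    by (intro bexI[of _ "- f"]) (auto intro: closed)
qed (auto intro: closed simp: add_ac)

lemma ring: "ring A"
  by (rule ringI[OF abelian_group monoidI]) (auto intro: closed simp: distrib_left distrib_right mult.assoc)

lemma module: "module (field_ring :: 'k::field ring) A"
  by (rule moduleI[OF fieldE(1)[OF field_field_ring] abelian_group])
     (auto intro: closed simp: field_ring_def scale_add_left scale_add_right scale_scale)

lemma finsum_eq_sum:
  assumes "finite I" "\<And>i. i \<in> I \<Longrightarrow> f i \<in> carrier A"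
  shows "finsum A f I = sum f I"
proof -
  interpret abelian_group A by (rule abelian_group)
  show ?thesis
    using assms by (induction I rule: finite_induct) (auto simp: finsum_insert Pi_def)
qed

lemma assoc_algebra: "assoc_algebra (field_ring :: 'k::field ring) A"
  by (rule assoc_algebra.intro[OF field_field_ring module ring assoc_algebra_axioms.intro])
     (auto simp: scale_mult_left scale_mult_right)

end


section \<open>Commuting generators\<close>

lemma (in group) centralizer_subgroup:
  assumes T: "T \<subseteq> carrier G"
  shows "subgroup {g \<in> carrier G. \<forall>t\<in>T. g \<otimes> t = t \<otimes> g} G" (is "subgroup ?C G")
proof (rule subgroupI)
  show "?C \<subseteq> carrier G" by blast
  have "\<one> \<in> ?C" using T by auto
  then show "?C \<noteq> {}" by blast
next
  fix g assume g: "g \<in> ?C"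
  have "inv g \<otimes> t = t \<otimes> inv g" if "t \<in> T" for t
  proof -
    have t: "t \<in> carrier G" and comm: "g \<otimes> t = t \<otimes> g" using that T g by auto
    have "inv g \<otimes> t = inv g \<otimes> (t \<otimes> g) \<otimes> inv g" using g t by (simp add: m_assoc)
    also have "\<dots> = inv g \<otimes> (g \<otimes> t) \<otimes> inv g" by (simp only: comm)
    also have "\<dots> = t \<otimes> inv g" using g t by (simp flip: m_assoc)
    finally show ?thesis .
  qed
  with g show "inv g \<in> ?C" by simp
next
  fix g h assume gh: "g \<in> ?C" "h \<in> ?C"
  have "(g \<otimes> h) \<otimes> t = t \<otimes> (g \<otimes> h)" if "t \<in> T" for t
  proof -
    have t: "t \<in> carrier G" "g \<otimes> t = t \<otimes> g" "h \<otimes> t = t \<otimes> h" using that T gh by auto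
    have "(g \<otimes> h) \<otimes> t = g \<otimes> (t \<otimes> h)" using gh t by (simp add: m_assoc)
    also have "\<dots> = (t \<otimes> g) \<otimes> h" using gh t(1) by (simp flip: m_assoc t(2))
    finally show ?thesis using gh t(1) by (simp add: m_assoc)
  qed
  with gh show "g \<otimes> h \<in> ?C" by simp
qed

text \<open>
  The centralizer argument is used twice: the generators centralize themselves, so the whole
  subgroup centralizes the generators, so the generators, and then the subgroup, centralize it.
\<close>

lemma (in group) comm_group_generated_by_commuting:
  assumes S: "S \<subseteq> carrier G" and comm: "\<And>s t. \<lbrakk>s \<in> S; t \<in> S\<rbrakk> \<Longrightarrow> s \<otimes> t = t \<otimes> s"
  shows "comm_group (subgroup_generated G S)"
proof (rule group.group_comm_groupI)
  let ?C = "\<lambda>T. {g \<in> carrier G. \<forall>t\<in>T. g \<otimes> t = t \<otimes> g}"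
  have H: "generate G S \<subseteq> carrier G" using S by (rule generate_incl)
  have "generate G S \<subseteq> ?C S"
    by (rule generate_subgroup_incl[OF _ centralizer_subgroup[OF S]]) (use S comm in auto)
  then have "S \<subseteq> ?C (generate G S)" using S H by fastforce
  then have "generate G S \<subseteq> ?C (generate G S)"
    by (rule generate_subgroup_incl[OF _ centralizer_subgroup[OF H]])
  moreover fix g h
  assume "g \<in> carrier (subgroup_generated G S)" "h \<in> carrier (subgroup_generated G S)"
  ultimately show "g \<otimes>\<^bsub>subgroup_generated G S\<^esub> h = h \<otimes>\<^bsub>subgroup_generated G S\<^esub> g"
    using S by (auto simp: carrier_subgroup_generated Int_absorb1)
qed simp


section \<open>Square-free solutions of multipermutation level 2\<close>

text \<open>
  That the second retraction is a point says that all classes act on the retraction alike.  In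
  particular \<open>[x]\<close> acts on \<open>[y]\<close> as \<open>[y]\<close> does, and square-freeness makes \<open>[y]\<close> fix itself.
\<close>

lemma lact_invariant_of_level_2:
  assumes closed: "r \<in> X \<times> X \<rightarrow> X \<times> X" and sf: "square_free X r"
    and level: "multipermutation_level_2 X r"
    and x: "x \<in> X" and y: "y \<in> X"
  shows "lact X r (fst (r (x, y))) = lact X r y"
proof -
  let ?R = "ret_rel X r" and ?Y = "ret_set X r" and ?s = "ret_map X r"
  define A where "A = ?R `` {x}"
  define C where "C = ?R `` {y}"
  have AC: "A \<in> ?Y" "C \<in> ?Y"
    using x y by (auto simp: A_def C_def ret_set_def quotientI)
  obtain Z where Z: "?Y // ret_rel ?Y ?s = {Z}"
    using level by (auto simp: multipermutation_level_2_def ret_set_def is_singleton_def)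
  have "ret_rel ?Y ?s `` {A} \<in> {Z}" "ret_rel ?Y ?s `` {C} \<in> {Z}"
    unfolding Z[symmetric] using AC by (auto intro: quotientI)
  moreover have "C \<in> ret_rel ?Y ?s `` {C}"
    using AC by (simp add: ret_rel_def)
  ultimately have "(A, C) \<in> ret_rel ?Y ?s" by auto
  then have "lact ?Y ?s A C = lact ?Y ?s C C"
    by (simp add: ret_rel_def)
  then have eq: "fst (?s (A, C)) = fst (?s (C, C))"
    using AC by (simp add: lact_def)
  \<comment> \<open>Elements of one class act alike, so square-freeness passes to the retraction.\<close>
  have fixed: "fst (r (u, v)) = v" if "u \<in> C" "v \<in> C" for u v
  proof -
    have "lact X r u = lact X r v" "v \<in> X"
      using that by (auto simp: C_def ret_rel_def)
    then have "lact X r u v = lact X r v v" by simp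
    with \<open>v \<in> X\<close> have "fst (r (u, v)) = fst (r (v, v))" by (simp add: lact_def)
    then show ?thesis using sf \<open>v \<in> X\<close> by (simp add: square_free_def)
  qed
  have "fst (?s (C, C)) \<subseteq> C"
    by (auto simp: ret_map_def fixed) (auto simp: C_def ret_rel_def)
  moreover have "fst (r (x, y)) \<in> fst (?s (A, C))"
  proof -
    have "fst (r (x, y)) \<in> X" using closed x y by (force simp: Pi_iff)
    then have "fst (r (x, y)) \<in> ?R `` {fst (r (x, y))}" "x \<in> A" "y \<in> C"
      using x y by (auto simp: A_def C_def ret_rel_def)
    then show ?thesis by (auto simp: ret_map_def)
  qed
  ultimately show ?thesis
    using eq by (auto simp: C_def ret_rel_def)
qed

text \<open>
  The consequences of level 2 on which everything else rests.  The last two conditions say that the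
  action does not change the \<open>\<sim>\<close>-class of a point, and that \<open>r (x, y) = (\<L>\<^sub>x y, \<L>\<^sub>y\<^sup>-\<^sup>1 x)\<close>.
\<close>

locale commuting_solution =
  fixes X :: "'x set" and r :: "'x \<times> 'x \<Rightarrow> 'x \<times> 'x"
  assumes closed: "r \<in> X \<times> X \<rightarrow> X \<times> X"
    and lact_Bij: "x \<in> X \<Longrightarrow> lact X r x \<in> Bij X"
    and lact_commute: "\<lbrakk>x \<in> X; y \<in> X; z \<in> X\<rbrakk> \<Longrightarrow>
      lact X r x (lact X r y z) = lact X r y (lact X r x z)"
    and lact_lact: "\<lbrakk>x \<in> X; y \<in> X\<rbrakk> \<Longrightarrow> lact X r (lact X r x y) = lact X r y"
    and lact_snd: "\<lbrakk>x \<in> X; y \<in> X\<rbrakk> \<Longrightarrow> lact X r y (snd (r (x, y))) = x"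

text \<open>
  Write \<open>r (x, y) = (u, v)\<close>.  Involutivity gives \<open>\<L>\<^sub>u v = x\<close>, where \<open>\<L>\<^sub>u = \<L>\<^sub>y\<close> by level 2; applying
  level 2 to \<open>\<L>\<^sub>y v = x\<close> gives \<open>\<L>\<^sub>v = \<L>\<^sub>x\<close>.  The Yang--Baxter identity \<open>\<L>\<^sub>u \<L>\<^sub>v = \<L>\<^sub>x \<L>\<^sub>y\<close> thus becomes
  \<open>\<L>\<^sub>y \<L>\<^sub>x = \<L>\<^sub>x \<L>\<^sub>y\<close>.
\<close>

lemma commuting_solution_of_level_2:
  assumes sol: "ybe_solution X r" and nd: "nondegenerate X r" and sf: "square_free X r"
    and inv: "involutive X r" and level: "multipermutation_level_2 X r"
  shows "commuting_solution X r"
proof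
  show closed: "r \<in> X \<times> X \<rightarrow> X \<times> X"
    using sol by (simp add: ybe_solution_def bij_betw_imp_funcset)
  have mem: "fst (r (x, y)) \<in> X" "snd (r (x, y)) \<in> X" if "x \<in> X" "y \<in> X" for x y
    using closed that by (auto simp: Pi_iff mem_Times_iff)
  show "lact X r x \<in> Bij X" if "x \<in> X" for x
    using nd that by (simp add: nondegenerate_def Bij_def) (simp add: lact_def)
  have lact: "lact X r x y = fst (r (x, y))" if "y \<in> X" for x y
    using that by (simp add: lact_def)
  show ll: "lact X r (lact X r x y) = lact X r y" if "x \<in> X" "y \<in> X" for x y
    using lact_invariant_of_level_2[OF closed sf level that] that by (simp add: lact)
  show ls: "lact X r y (snd (r (x, y))) = x" if "x \<in> X" "y \<in> X" for x y
  proof -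
    have "r (fst (r (x, y)), snd (r (x, y))) = (x, y)"
      using inv that by (simp add: involutive_def)
    then have "lact X r (fst (r (x, y))) (snd (r (x, y))) = x"
      using mem[OF that] by (simp add: lact)
    then show ?thesis using ll[OF that] that by (simp add: lact)
  qed
  show "lact X r x (lact X r y z) = lact X r y (lact X r x z)"
    if xyz: "x \<in> X" "y \<in> X" "z \<in> X" for x y z
  proof -
    let ?u = "fst (r (x, y))" and ?v = "snd (r (x, y))"
    note uv = mem[OF xyz(1,2)]
    have "fst (r12 r (r23 r (r12 r (x, y, z)))) = fst (r23 r (r12 r (r23 r (x, y, z))))"
      using sol xyz unfolding ybe_solution_def by simp
    then have "fst (r (?u, fst (r (?v, z)))) = fst (r (x, fst (r (y, z))))"
      by (simp add: r12_def r23_def split_beta)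
    then have "lact X r ?u (lact X r ?v z) = lact X r x (lact X r y z)"
      using xyz uv mem by (simp add: lact)
    moreover have "lact X r ?u = lact X r y"
      using ll[OF xyz(1,2)] xyz by (simp add: lact)
    moreover have "lact X r ?v = lact X r x"
      using ll[of y ?v] ls[OF xyz(1,2)] uv xyz by simp
    ultimately show ?thesis by simp
  qed
qed


context commuting_solution
begin

abbreviation "L \<equiv> lact X r"
abbreviation "G \<equiv> perm_group X r"
abbreviation "deg \<equiv> mon_degree X r"

lemma perm_group_mult: "\<lbrakk>g \<in> Bij X; h \<in> Bij X\<rbrakk> \<Longrightarrow> g \<otimes>\<^bsub>G\<^esub> h = compose X g h"
  by (simp add: perm_group_def BijGroup_def)

lemma perm_group_one: "\<one>\<^bsub>G\<^esub> = (\<lambda>x\<in>X. x)"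
  by (simp add: perm_group_def BijGroup_def)

sublocale G: comm_group "perm_group X r"
  unfolding perm_group_def
proof (rule group.comm_group_generated_by_commuting[OF group_BijGroup])
  show "L ` X \<subseteq> carrier (BijGroup X)"
    using lact_Bij by (auto simp: BijGroup_def)
  show "s \<otimes>\<^bsub>BijGroup X\<^esub> t = t \<otimes>\<^bsub>BijGroup X\<^esub> s" if st: "s \<in> L ` X" "t \<in> L ` X" for s t
  proof -
    obtain x y where xy: "s = L x" "t = L y" "x \<in> X" "y \<in> X" using st by blast
    have "compose X s t = compose X t s"
      unfolding compose_def xy(1,2) by (rule restrict_ext) (rule lact_commute[OF xy(3,4)])
    then show ?thesis using xy lact_Bij by (simp add: BijGroup_def)
  qed
qed

lemma carrier_perm_group: "carrier G = generate (BijGroup X) (L ` X)"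
proof -
  have "L ` X \<subseteq> carrier (BijGroup X)" using lact_Bij by (auto simp: BijGroup_def)
  then show ?thesis
    unfolding perm_group_def carrier_subgroup_generated by (simp only: Int_absorb1)
qed

lemma lact_in_perm_group: "x \<in> X \<Longrightarrow> L x \<in> carrier G"
  by (auto simp: carrier_perm_group intro: generate.incl)

lemma perm_group_Bij: "g \<in> carrier G \<Longrightarrow> g \<in> Bij X"
proof -
  have "L ` X \<subseteq> carrier (BijGroup X)" using lact_Bij by (auto simp: BijGroup_def)
  moreover assume "g \<in> carrier G"
  ultimately have "g \<in> carrier (BijGroup X)"
    using group.generate_in_carrier[OF group_BijGroup] unfolding carrier_perm_group by blast
  then show ?thesis by (simp add: BijGroup_def)
qed

lemma perm_group_bij_betw: "g \<in> carrier G \<Longrightarrow> bij_betw g X X"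
  using perm_group_Bij by (simp add: Bij_def)

lemma perm_group_mem: "\<lbrakk>g \<in> carrier G; x \<in> X\<rbrakk> \<Longrightarrow> g x \<in> X"
  using perm_group_bij_betw bij_betwE by metis

lemma perm_group_mult_apply:
  "\<lbrakk>g \<in> carrier G; h \<in> carrier G; x \<in> X\<rbrakk> \<Longrightarrow> (g \<otimes>\<^bsub>G\<^esub> h) x = g (h x)"
  by (simp add: perm_group_mult perm_group_Bij compose_eq)

text \<open>The degree of a variable is invariant: this is level 2, extended from the generators.\<close>

lemma lact_perm_group:
  assumes "g \<in> carrier G" "x \<in> X"
  shows "L (g x) = L x"
proof -
  interpret B: group "BijGroup X" by (rule group_BijGroup)
  let ?H = "{g \<in> Bij X. \<forall>x\<in>X. L (g x) = L x}"
  have "subgroup ?H (BijGroup X)"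
  proof (rule B.subgroupI)
    show "?H \<subseteq> carrier (BijGroup X)" by (auto simp: BijGroup_def)
    have "(\<lambda>x\<in>X. x) \<in> ?H" by (simp add: id_Bij)
    then show "?H \<noteq> {}" by blast
  next
    fix g assume g: "g \<in> ?H"
    have "L (inv_into X g x) = L x" if "x \<in> X" for x
    proof -
      have "g (inv_into X g x) = x" "inv_into X g x \<in> X"
        using g that by (auto simp: Bij_def bij_betw_inv_into_right intro: Bij_inv_into_mem)
      then show ?thesis using g by (metis (mono_tags, lifting) mem_Collect_eq)
    qed
    then show "inv\<^bsub>BijGroup X\<^esub> g \<in> ?H"
      using g by (simp add: inv_BijGroup restrict_inv_into_Bij)
  next
    fix g h assume gh: "g \<in> ?H" "h \<in> ?H"
    then have "h x \<in> X" if "x \<in> X" for x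
      using that Bij_imp_funcset[of h X] by auto
    with gh show "g \<otimes>\<^bsub>BijGroup X\<^esub> h \<in> ?H"
      by (auto simp: BijGroup_def compose_Bij compose_eq)
  qed
  moreover have "L ` X \<subseteq> ?H" using lact_Bij lact_lact by auto
  ultimately have "generate (BijGroup X) (L ` X) \<subseteq> ?H"
    by (intro B.generate_subgroup_incl)
  then show ?thesis using assms by (auto simp: carrier_perm_group)
qed

text \<open>
  Lets the product range over a common index set, so that degrees of different monomials can be
  multiplied factor by factor.
\<close>

lemma deg_superset:
  assumes A: "finite A" "set_mset m \<subseteq> A" "A \<subseteq> X"
  shows "deg m = (\<Otimes>\<^bsub>G\<^esub>x\<in>A. L x [^]\<^bsub>G\<^esub> count m x)"
  unfolding mon_degree_def
proof (rule G.finprod_mono_neutral_cong_left[OF A(1,2)])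
  fix x assume "x \<in> A - set_mset m"
  then have "count m x = 0" by (simp add: not_in_iff)
  then show "L x [^]\<^bsub>G\<^esub> count m x = \<one>\<^bsub>G\<^esub>" by simp
qed (use A(3) in \<open>auto intro!: lact_in_perm_group G.nat_pow_closed\<close>)

lemma deg_closed: "set_mset m \<subseteq> X \<Longrightarrow> deg m \<in> carrier G"
  unfolding mon_degree_def by (intro G.finprod_closed) (auto intro!: lact_in_perm_group)

lemma deg_empty [simp]: "deg {#} = \<one>\<^bsub>G\<^esub>"
  by (simp add: mon_degree_def)

lemma deg_single [simp]: "x \<in> X \<Longrightarrow> deg {#x#} = L x"
  by (simp add: mon_degree_def lact_in_perm_group)

lemma deg_add:
  assumes "set_mset m \<subseteq> X" "set_mset n \<subseteq> X"
  shows "deg (m + n) = deg m \<otimes>\<^bsub>G\<^esub> deg n"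
proof -
  let ?A = "set_mset m \<union> set_mset n"
  have L: "L x \<in> carrier G" if "x \<in> ?A" for x using assms that lact_in_perm_group by auto
  have A: "finite ?A" "?A \<subseteq> X" "set_mset m \<subseteq> ?A" "set_mset n \<subseteq> ?A" "set_mset (m + n) \<subseteq> ?A"
    using assms by auto
  have "deg (m + n) = (\<Otimes>\<^bsub>G\<^esub>x\<in>?A. L x [^]\<^bsub>G\<^esub> count (m + n) x)"
    by (rule deg_superset[OF A(1,5,2)])
  also have "\<dots> = (\<Otimes>\<^bsub>G\<^esub>x\<in>?A. L x [^]\<^bsub>G\<^esub> count m x \<otimes>\<^bsub>G\<^esub> L x [^]\<^bsub>G\<^esub> count n x)"
    by (rule G.finprod_cong') (auto simp: G.nat_pow_mult L intro!: G.m_closed G.nat_pow_closed)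
  also have "\<dots> = (\<Otimes>\<^bsub>G\<^esub>x\<in>?A. L x [^]\<^bsub>G\<^esub> count m x) \<otimes>\<^bsub>G\<^esub> (\<Otimes>\<^bsub>G\<^esub>x\<in>?A. L x [^]\<^bsub>G\<^esub> count n x)"
    by (rule G.finprod_multf) (auto intro!: L G.nat_pow_closed)
  also have "\<dots> = deg m \<otimes>\<^bsub>G\<^esub> deg n"
    by (simp only: deg_superset[OF A(1,3,2)] deg_superset[OF A(1,4,2)])
  finally show ?thesis .
qed

lemma image_mset_mem:
  "\<lbrakk>g \<in> carrier G; set_mset m \<subseteq> X\<rbrakk> \<Longrightarrow> set_mset (image_mset g m) \<subseteq> X"
  using perm_group_mem by auto

text \<open>
  The compatibility of grading and action: in the abelian group \<open>\<G>\<close> conjugation is trivial, so the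
  crossed module condition asks that the action preserve degrees.
\<close>

lemma deg_image:
  "\<lbrakk>g \<in> carrier G; set_mset m \<subseteq> X\<rbrakk> \<Longrightarrow> deg (image_mset g m) = deg m"
proof (induction m)
  case (add x m)
  then have "deg ({#g x#} + image_mset g m) = deg ({#x#} + m)"
    using image_mset_mem[of g m] by (subst (1 2) deg_add) (auto simp: lact_perm_group perm_group_mem)
  then show ?case by simp
qed simp

end


section \<open>The symmetric algebra as a crossed module algebra\<close>

lemma sym_act_eq: "sym_act g = linear_extension (\<lambda>m. Poly_Mapping.single (image_mset g m) 1)"
  by (rule ext) (simp add: sym_act_def linear_extension_def scale_single)

lemma sym_act_single [simp]:
  "sym_act g (Poly_Mapping.single m c) = Poly_Mapping.single (image_mset g m) c"
  by (simp add: sym_act_eq scale_single)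

lemma sym_act_zero [simp]: "sym_act g 0 = 0"
  by (simp add: sym_act_eq)

lemma sym_act_add: "sym_act g (f + h) = sym_act g f + sym_act g h"
  by (simp add: sym_act_eq linear_extension_add)

lemma sym_act_scale:
  "sym_act g (Poly_Mapping.map ((*) c) f) = Poly_Mapping.map ((*) c) (sym_act g f)"
  by (simp add: sym_act_eq linear_extension_scale)

lemma sym_act_mult:
  fixes f h :: "'x multiset \<Rightarrow>\<^sub>0 'k::field"
  shows "sym_act g (f * h) = sym_act g f * sym_act g h"
proof (rule monomial_induct[of f UNIV])
  fix m and c :: 'k
  show "sym_act g (Poly_Mapping.single m c * h) = sym_act g (Poly_Mapping.single m c) * sym_act g h"
    by (rule monomial_induct[of h UNIV]) (simp_all add: mult_single distrib_left sym_act_add)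
qed (simp_all add: distrib_right sym_act_add)

lemma keys_sym_act:
  "Poly_Mapping.keys (sym_act g f) \<subseteq> image_mset g ` Poly_Mapping.keys f"
  unfolding sym_act_eq by (rule keys_linear_extension) auto

interpretation sym: submonoid_algebra "{m. set_mset m \<subseteq> X}" for X :: "'x set"
  by standard auto

lemmas sym_algebra_operations [simp] = sym.operations[folded sym_algebra_def]
lemmas sym_algebra_closed = sym.closed[folded sym_algebra_def]
lemmas sym_algebra_finsum = sym.finsum_eq_sum[folded sym_algebra_def]
lemmas sym_algebra_mem = sym.mem_carrier[folded sym_algebra_def, unfolded subset_iff mem_Collect_eq]
lemmas sym_algebra_assoc_algebra = sym.assoc_algebra[folded sym_algebra_def]

context commuting_solution
begin

abbreviation "homogeneous \<equiv> sym_homogeneous X r"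

definition homogeneous_part :: "('x multiset \<Rightarrow>\<^sub>0 'k::field) \<Rightarrow> ('x \<Rightarrow> 'x) \<Rightarrow> ('x multiset \<Rightarrow>\<^sub>0 'k)" where
  "homogeneous_part f g = Poly_Mapping.mapp (\<lambda>m c. c when deg m = g) f"

lemma lookup_homogeneous_part:
  "Poly_Mapping.lookup (homogeneous_part f g) m = (Poly_Mapping.lookup f m when deg m = g)"
  by (simp add: homogeneous_part_def lookup_mapp when_def in_keys_iff)

lemma homogeneous_part_eq_sum:
  "homogeneous_part f g =
     (\<Sum>m\<in>{m \<in> Poly_Mapping.keys f. deg m = g}. Poly_Mapping.single m (Poly_Mapping.lookup f m))"
  by (rule poly_mapping_eqI)
     (auto simp: lookup_homogeneous_part lookup_sum lookup_single when_def in_keys_iff)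

lemma homogeneous_part_support:
  "{g. homogeneous_part f g \<noteq> 0} = deg ` Poly_Mapping.keys f"
proof -
  have "homogeneous_part f g \<noteq> 0 \<longleftrightarrow> (\<exists>m\<in>Poly_Mapping.keys f. deg m = g)" for g
    by (auto simp: poly_mapping_eq_iff fun_eq_iff lookup_homogeneous_part in_keys_iff)
  then show ?thesis by auto
qed

lemma deg_mem:
  "\<lbrakk>f \<in> carrier (sym_algebra X); m \<in> Poly_Mapping.keys f\<rbrakk> \<Longrightarrow> deg m \<in> carrier G"
  by (intro deg_closed) (auto simp: sym_algebra_mem)

lemma is_decomposition_homogeneous_part:
  assumes f: "f \<in> carrier (sym_algebra X)"
  shows "is_decomposition G (sym_algebra X) homogeneous f (homogeneous_part f)"
  unfolding is_decomposition_def sym_algebra_operations homogeneous_part_support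
proof (intro conjI ballI allI impI)
  have closed: "homogeneous_part f g \<in> carrier (sym_algebra X)" for g
    using f by (auto simp: sym_algebra_mem lookup_homogeneous_part in_keys_iff)
  show "homogeneous_part f g \<in> homogeneous g" for g
    using closed by (auto simp: sym_homogeneous_def lookup_homogeneous_part in_keys_iff)
  show "homogeneous_part f g = 0" if "g \<notin> carrier G" for g
  proof (rule ccontr)
    assume "homogeneous_part f g \<noteq> 0"
    then have "g \<in> deg ` Poly_Mapping.keys f" by (simp flip: homogeneous_part_support)
    with deg_mem[OF f] that show False by blast
  qed
  have "(\<Sum>g\<in>deg ` Poly_Mapping.keys f. homogeneous_part f g) =
      (\<Sum>m\<in>Poly_Mapping.keys f. Poly_Mapping.single m (Poly_Mapping.lookup f m))"
    unfolding homogeneous_part_eq_sum by (rule sum.image_gen[OF finite_keys, symmetric])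
  then show "f = finsum (sym_algebra X) (homogeneous_part f) (deg ` Poly_Mapping.keys f)"
    by (simp only: sym_algebra_finsum[OF finite_imageI[OF finite_keys] closed]
          sum_single_lookup[symmetric])
qed simp

text \<open>
  The coefficient at \<open>m\<close> of a decomposition \<open>u\<close> can only come from the component \<open>u (deg m)\<close>.
\<close>

lemma is_decomposition_unique:
  assumes "is_decomposition G (sym_algebra X) homogeneous f u"
  shows "u = homogeneous_part f"
proof
  fix g
  let ?S = "{g. u g \<noteq> 0}"
  have fin: "finite ?S" and f: "f = finsum (sym_algebra X) u ?S"
    and out: "\<And>g. g \<notin> carrier G \<Longrightarrow> u g = 0"
    and hom: "\<And>g. g \<in> carrier G \<Longrightarrow> u g \<in> homogeneous g"
    using assms by (auto simp: is_decomposition_def)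
  have closed: "u g \<in> carrier (sym_algebra X)" for g
    using out[of g] hom[of g] by (cases "g \<in> carrier G") (auto simp: sym_homogeneous_def sym_algebra_closed)
  have off: "Poly_Mapping.lookup (u g) m = 0" if "deg m \<noteq> g" for g m
    using out[of g] hom[of g] that by (cases "g \<in> carrier G") (auto simp: sym_homogeneous_def in_keys_iff)
  have "f = sum u ?S"
    using f sym_algebra_finsum[OF fin closed] by simp
  then have "Poly_Mapping.lookup f m = (\<Sum>h\<in>?S. Poly_Mapping.lookup (u h) m)" for m
    by (simp add: lookup_sum)
  also have "(\<Sum>h\<in>?S. Poly_Mapping.lookup (u h) m) =
      (\<Sum>h\<in>?S. if h = deg m then Poly_Mapping.lookup (u (deg m)) m else 0)" for m
    by (rule sum.cong) (auto simp: off)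
  also have "(\<Sum>h\<in>?S. if h = deg m then Poly_Mapping.lookup (u (deg m)) m else 0) =
      Poly_Mapping.lookup (u (deg m)) m" for m
    using fin by simp
  finally show "u g = homogeneous_part f g"
    by (intro poly_mapping_eqI) (auto simp: lookup_homogeneous_part when_def off)
qed

lemma components_eq:
  "f \<in> carrier (sym_algebra X) \<Longrightarrow>
    components G (sym_algebra X) homogeneous f = homogeneous_part f"
  unfolding components_def
  using is_decomposition_homogeneous_part is_decomposition_unique by blast

lemma submodule_homogeneous:
  "submodule (homogeneous g :: ('x multiset \<Rightarrow>\<^sub>0 'k::field) set) field_ring (sym_algebra X)"
proof -
  interpret module "field_ring :: 'k ring" "sym_algebra X"
    using sym_algebra_assoc_algebra by (rule assoc_algebra.axioms(2))
  show ?thesis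
  proof (rule submoduleI)
    fix f h :: "'x multiset \<Rightarrow>\<^sub>0 'k" assume fh: "f \<in> homogeneous g" "h \<in> homogeneous g"
    have "Poly_Mapping.keys (f + h) \<subseteq> Poly_Mapping.keys f \<union> Poly_Mapping.keys h"
      by (rule Poly_Mapping.keys_add)
    with fh show "f \<oplus>\<^bsub>sym_algebra X\<^esub> h \<in> homogeneous g"
      by (auto simp: sym_homogeneous_def sym_algebra_closed)
  next
    fix c and f :: "'x multiset \<Rightarrow>\<^sub>0 'k" assume f: "f \<in> homogeneous g"
    then show "c \<odot>\<^bsub>sym_algebra X\<^esub> f \<in> homogeneous g"
      using keys_scale[of c f] by (auto simp: sym_homogeneous_def sym_algebra_closed)
    show "\<ominus>\<^bsub>sym_algebra X\<^esub> f \<in> homogeneous g"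
    proof -
      have "\<ominus>\<^bsub>sym_algebra X\<^esub> f = - f"
        using f by (intro minus_equality) (auto simp: sym_homogeneous_def sym_algebra_closed)
      then show ?thesis
        using f by (auto simp: sym_homogeneous_def sym_algebra_closed in_keys_iff)
    qed
  qed (auto simp: sym_homogeneous_def sym_algebra_closed)
qed

lemma sym_act_closed:
  assumes "g \<in> carrier G" "f \<in> carrier (sym_algebra X)"
  shows "sym_act g f \<in> carrier (sym_algebra X)"
proof -
  have "set_mset m \<subseteq> X" if "m \<in> Poly_Mapping.keys f" for m
    using assms(2) that by (auto simp: sym_algebra_mem)
  then have "set_mset m \<subseteq> X" if "m \<in> Poly_Mapping.keys (sym_act g f)" for m
    using that keys_sym_act[of g f] image_mset_mem[OF assms(1)] by blast
  then show ?thesis by (auto simp: sym_algebra_mem)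
qed

lemma sym_act_one:
  "f \<in> carrier (sym_algebra X) \<Longrightarrow> sym_act \<one>\<^bsub>G\<^esub> f = f"
  unfolding sym_algebra_def sym.mem_carrier
proof (induction f rule: monomial_induct)
  case (single m c)
  then have "image_mset (\<lambda>x\<in>X. x) m = image_mset (\<lambda>x. x) m"
    by (intro image_mset_cong) auto
  then show ?case by (simp only: perm_group_one sym_act_single multiset.map_ident)
qed (simp_all add: sym_act_add)

lemma sym_act_comp:
  assumes "g \<in> carrier G" "h \<in> carrier G"
  shows "f \<in> carrier (sym_algebra X) \<Longrightarrow> sym_act (g \<otimes>\<^bsub>G\<^esub> h) f = sym_act g (sym_act h f)"
  unfolding sym_algebra_def sym.mem_carrier
proof (induction f rule: monomial_induct)
  case (single m c)
  then have "image_mset (g \<otimes>\<^bsub>G\<^esub> h) m = image_mset (\<lambda>x. g (h x)) m"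
    using assms by (intro image_mset_cong) (auto simp: perm_group_mult_apply)
  then show ?case by (simp add: multiset.map_comp comp_def)
qed (simp_all add: sym_act_add)

lemma sym_act_homogeneous:
  assumes g: "g \<in> carrier G" and f: "f \<in> homogeneous h"
  shows "sym_act g f \<in> homogeneous h"
proof -
  have "deg (image_mset g m) = h" if "m \<in> Poly_Mapping.keys f" for m
    using f that deg_image[OF g, of m] by (auto simp: sym_homogeneous_def sym_algebra_mem)
  then have "deg m = h" if "m \<in> Poly_Mapping.keys (sym_act g f)" for m
    using that keys_sym_act[of g f] by blast
  then show ?thesis
    using sym_act_closed[OF g, of f] f by (simp add: sym_homogeneous_def)
qed

lemma homogeneous_mult:
  assumes "f \<in> homogeneous g" "f' \<in> homogeneous h"
  shows "f * f' \<in> homogeneous (g \<otimes>\<^bsub>G\<^esub> h)"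
proof -
  have "deg (m + n) = g \<otimes>\<^bsub>G\<^esub> h"
    if "m \<in> Poly_Mapping.keys f" "n \<in> Poly_Mapping.keys f'" for m n
    using assms that deg_add[of m n] by (auto simp: sym_homogeneous_def sym_algebra_mem)
  then have "deg m = g \<otimes>\<^bsub>G\<^esub> h" if "m \<in> Poly_Mapping.keys (f * f')" for m
    using that Poly_Mapping.keys_mult[of f f'] by blast
  then show ?thesis using assms by (auto simp: sym_homogeneous_def sym_algebra_closed)
qed

theorem crossed_module_algebra_sym_algebra:
  "crossed_module_algebra (field_ring :: 'k::field ring) G (sym_algebra X) homogeneous sym_act"
proof -
  note assoc = sym_algebra_assoc_algebra[where ?'k = 'k and X = X]
  have conj: "g \<otimes>\<^bsub>G\<^esub> h \<otimes>\<^bsub>G\<^esub> inv\<^bsub>G\<^esub> g = h" if "g \<in> carrier G" "h \<in> carrier G" for g h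
    using that by (simp add: G.m_comm[of g h] G.m_assoc)
  have "crossed_module_axioms (field_ring :: 'k ring) G (sym_algebra X) homogeneous sym_act"
  proof (rule crossed_module_axioms.intro)
    show "\<exists>!u. is_decomposition G (sym_algebra X) homogeneous f u"
      if "f \<in> carrier (sym_algebra X)" for f :: "'x multiset \<Rightarrow>\<^sub>0 'k"
      using that is_decomposition_homogeneous_part is_decomposition_unique by blast
  qed (simp_all add: submodule_homogeneous sym_act_closed sym_act_add sym_act_scale sym_act_one
         sym_act_comp conj sym_act_homogeneous)
  then have "crossed_module (field_ring :: 'k ring) G (sym_algebra X) homogeneous sym_act"
    by (intro crossed_module.intro assoc_algebra.axioms(1,2)[OF assoc] G.group_axioms)
  moreover have "(1 :: 'x multiset \<Rightarrow>\<^sub>0 'k) \<in> homogeneous \<one>\<^bsub>G\<^esub>"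
    by (simp add: sym_homogeneous_def sym_algebra_closed flip: single_one)
  moreover have "sym_act g (1 :: 'x multiset \<Rightarrow>\<^sub>0 'k) = 1" for g :: "'x \<Rightarrow> 'x"
    by (simp flip: single_one)
  ultimately show ?thesis
    by (intro crossed_module_algebra.intro assoc crossed_module_algebra_axioms.intro)
       (simp_all add: homogeneous_mult sym_act_mult)
qed

end


section \<open>Words modulo the relations\<close>

text \<open>
  The congruence on words whose quotient is the monoid with the defining relations of the quadratic
  algebra.  Compatibility with right multiplication is built into the relations, which carry an
  arbitrary tail \<open>w\<close>.
\<close>

inductive word_equiv :: "'x set \<Rightarrow> ('x \<times> 'x \<Rightarrow> 'x \<times> 'x) \<Rightarrow> 'x list \<Rightarrow> 'x list \<Rightarrow> bool" for X r where
  reflexive: "word_equiv X r w w"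
| relation: "\<lbrakk>x \<in> X; y \<in> X; r (x, y) = (z, t)\<rbrakk> \<Longrightarrow> word_equiv X r (x # y # w) (z # t # w)"
| prefix: "\<lbrakk>x \<in> X; word_equiv X r v w\<rbrakk> \<Longrightarrow> word_equiv X r (x # v) (x # w)"
| symmetric: "word_equiv X r v w \<Longrightarrow> word_equiv X r w v"
| transitive: "\<lbrakk>word_equiv X r u v; word_equiv X r v w\<rbrakk> \<Longrightarrow> word_equiv X r u w"

context commuting_solution
begin

text \<open>
  The product \<open>x\<^sub>1 \<bullet> (x\<^sub>2 \<bullet> \<dots>)\<close> of the letters in \<open>k[V]\<^sup>o\<^sup>p\<close>.  Unfolding the recursion, the
  letter \<open>x\<^sub>i\<close> contributes the factor \<open>\<L>\<^bsub>x\<^sub>1\<^esub> \<dots> \<L>\<^bsub>x\<^sub>i\<^sub>-\<^sub>1\<^esub> x\<^sub>i\<close>.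
\<close>

primrec twist :: "'x list \<Rightarrow> 'x multiset" where
  "twist [] = {#}"
| "twist (x # w) = add_mset x (image_mset (L x) (twist w))"

lemma lact_mem: "\<lbrakk>x \<in> X; y \<in> X\<rbrakk> \<Longrightarrow> L x y \<in> X"
  using lact_in_perm_group perm_group_mem by blast

lemma twist_mem: "set w \<subseteq> X \<Longrightarrow> set_mset (twist w) \<subseteq> X"
  by (induction w) (auto simp: lact_mem)

lemma deg_twist_Cons:
  assumes "x \<in> X" "set w \<subseteq> X"
  shows "deg (twist (x # w)) = L x \<otimes>\<^bsub>G\<^esub> deg (twist w)"
proof -
  have "deg ({#x#} + image_mset (L x) (twist w)) = L x \<otimes>\<^bsub>G\<^esub> deg (twist w)"
    using assms twist_mem image_mset_mem[OF lact_in_perm_group]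
    by (subst deg_add) (auto simp: deg_image lact_in_perm_group)
  then show ?thesis by simp
qed

text \<open>
  This is the opposite product \<open>f \<bullet> g = (|f|.g) f\<close> on monomials, so it makes \<open>twist\<close> multiplicative.
\<close>

lemma twist_append:
  "\<lbrakk>set u \<subseteq> X; set v \<subseteq> X\<rbrakk> \<Longrightarrow>
    twist (u @ v) = twist u + image_mset (deg (twist u)) (twist v)"
proof (induction u)
  case Nil
  have "image_mset (\<lambda>x\<in>X. x) (twist v) = image_mset (\<lambda>x. x) (twist v)"
    using twist_mem[OF Nil(2)] by (intro image_mset_cong) auto
  then show ?case by (simp only: perm_group_one twist.simps deg_empty append_Nil multiset.map_ident add_0)
next
  case (Cons x u)
  then have xu: "x \<in> X" "set u \<subseteq> X" and v: "set_mset (twist v) \<subseteq> X"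
    using twist_mem by auto
  have "image_mset (deg (twist (x # u))) (twist v) =
      image_mset (\<lambda>y. L x (deg (twist u) y)) (twist v)"
    unfolding deg_twist_Cons[OF xu] using xu v
    by (intro image_mset_cong perm_group_mult_apply lact_in_perm_group deg_closed twist_mem) auto
  then show ?case using Cons by (simp add: multiset.map_comp comp_def)
qed

lemma twist_surj:
  "set_mset m \<subseteq> X \<Longrightarrow> \<exists>w. set w \<subseteq> X \<and> twist w = m"
proof (induction m)
  case empty
  show ?case by (rule exI[of _ "[]"]) simp
next
  case (add x m)
  have m: "set_mset m \<subseteq> X" and x: "x \<in> X" using add.prems by simp_all
  with add.IH obtain w where w: "set w \<subseteq> X" "twist w = m" by blast
  \<comment> \<open>Appending \<open>y\<close> to \<open>w\<close> adds the factor \<open>deg m y\<close>, and \<open>deg m\<close> permutes \<open>X\<close>.\<close>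
  have "x \<in> deg m ` X"
    using bij_betw_imp_surj_on[OF perm_group_bij_betw[OF deg_closed[OF m]]] x by simp
  then obtain y where y: "y \<in> X" "deg m y = x" by blast
  have "set (w @ [y]) \<subseteq> X" using w y by simp
  moreover have "twist (w @ [y]) = add_mset x m"
    using w y by (subst twist_append) simp_all
  ultimately show ?case by blast
qed

lemma r_eq:
  assumes "x \<in> X" "y \<in> X" "r (x, y) = (z, t)"
  shows "z \<in> X" "t \<in> X" "z = L x y" "L y t = x"
proof -
  have "r (x, y) \<in> X \<times> X" using funcset_mem[OF closed] assms(1,2) by simp
  then show "z \<in> X" "t \<in> X" using assms(3) by auto
  show "z = L x y" using assms(2,3) by (simp add: lact_def)
  show "L y t = x" using lact_snd[OF assms(1,2)] assms(3) by simp
qed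

text \<open>
  The first two factors are \<open>x\<close> and \<open>\<L>\<^sub>x y\<close> on the left, \<open>\<L>\<^sub>x y\<close> and \<open>\<L>\<^sub>z t = \<L>\<^sub>y t = x\<close> on the right.
  On the tail act \<open>\<L>\<^sub>x \<L>\<^sub>y\<close> and \<open>\<L>\<^sub>z \<L>\<^sub>t = \<L>\<^sub>y \<L>\<^sub>x\<close>, which agree by commutativity.
\<close>

lemma twist_swap:
  assumes x: "x \<in> X" and y: "y \<in> X" and r: "r (x, y) = (z, t)" and w: "set w \<subseteq> X"
  shows "twist (x # y # w) = twist (z # t # w)"
proof -
  note zt = r_eq[OF x y r]
  have Lz: "L z = L y" using zt lact_lact x y by simp
  have Lt: "L t = L x" using lact_lact[OF y zt(2)] zt(4) by simp
  have "image_mset (\<lambda>u. L x (L y u)) (twist w) = image_mset (\<lambda>u. L y (L x u)) (twist w)"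
    using twist_mem[OF w] x y by (intro image_mset_cong lact_commute) auto
  moreover have "L z t = x" using Lz zt(4) by simp
  ultimately show ?thesis
    by (simp add: multiset.map_comp comp_def Lz Lt zt(3)[symmetric] add_mset_commute)
qed

lemma word_equiv_twist:
  "word_equiv X r v w \<Longrightarrow> (set v \<subseteq> X \<longleftrightarrow> set w \<subseteq> X) \<and> (set v \<subseteq> X \<longrightarrow> twist v = twist w)"
proof (induction rule: word_equiv.induct)
  case (relation x y z t w)
  then have "set (z # t # w) \<subseteq> X \<longleftrightarrow> set w \<subseteq> X" using r_eq(1,2)[OF relation] by simp
  then show ?case using twist_swap[OF relation] relation(1,2) by (simp del: twist.simps)
qed auto

text \<open>
  A factor of the tail \<open>w\<close> of \<open>y # w\<close> has the form \<open>\<L>\<^sub>y z\<close> with \<open>z\<close> a factor of \<open>w\<close>.  Inductively \<open>z\<close>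
  is moved to the front of \<open>w\<close>, and one relation turns \<open>y z\<close> into a word starting with \<open>\<L>\<^sub>y z\<close>.
\<close>

lemma word_equiv_bring_to_front:
  "\<lbrakk>set w \<subseteq> X; x \<in># twist w\<rbrakk> \<Longrightarrow> \<exists>w'. word_equiv X r w (x # w')"
proof (induction w arbitrary: x)
  case (Cons y w)
  show ?case
  proof (cases "x = y")
    case True
    then show ?thesis by (blast intro: word_equiv.reflexive)
  next
    case False
    then obtain z where z: "z \<in># twist w" "x = L y z" using Cons.prems by auto
    with Cons obtain w' where w': "word_equiv X r w (z # w')" by auto
    have yz: "y \<in> X" "z \<in> X" using Cons.prems twist_mem[of w] z by auto
    then have "word_equiv X r (y # z # w') (fst (r (y, z)) # snd (r (y, z)) # w')"
      by (intro word_equiv.relation) auto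
    moreover have "fst (r (y, z)) = x" using z yz by (simp add: lact_def)
    ultimately have "word_equiv X r (y # w) (x # snd (r (y, z)) # w')"
      using word_equiv.prefix[OF yz(1) w'] by (auto intro: word_equiv.transitive)
    then show ?thesis by blast
  qed
qed simp

text \<open>
  Since \<open>u = x u'\<close> has the factor \<open>x\<close>, so has \<open>v\<close>, which is therefore equivalent to some \<open>x v'\<close>.
  As \<open>\<L>\<^sub>x\<close> is injective, \<open>u'\<close> and \<open>v'\<close> have the same monomial.
\<close>

lemma word_equiv_if_twist_eq:
  "\<lbrakk>set u \<subseteq> X; set v \<subseteq> X; twist u = twist v\<rbrakk> \<Longrightarrow> word_equiv X r u v"
proof (induction u arbitrary: v)
  case Nil
  then show ?case by (cases v) (auto intro: word_equiv.reflexive)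
next
  case (Cons x u)
  have "x \<in># twist (x # u)" by simp
  then have x: "x \<in> X" "x \<in># twist v" using Cons.prems(1) unfolding Cons.prems(3) by simp_all
  then obtain v' where v': "word_equiv X r v (x # v')"
    using word_equiv_bring_to_front Cons.prems by blast
  then have mem: "set v' \<subseteq> X" and eq: "twist v = twist (x # v')"
    using word_equiv_twist[OF v'] Cons.prems by auto
  have "image_mset (L x) (twist u) = image_mset (L x) (twist v')"
    using eq Cons.prems by simp
  moreover have "inj_on (L x) (set_mset (twist u) \<union> set_mset (twist v'))"
    using perm_group_bij_betw[OF lact_in_perm_group[OF x(1)]] twist_mem[of u] twist_mem[OF mem] Cons.prems
    by (auto simp: bij_betw_def intro: inj_on_subset)
  ultimately have "twist u = twist v'"
    using image_mset_eq_image_mset_plusD[of "L x" "twist u" "twist v'" "{#}"] by simp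
  then have "word_equiv X r (x # u) (x # v')"
    using Cons.IH[of v'] Cons.prems(1) mem x by (simp add: word_equiv.prefix)
  then show ?case using v' by (blast intro: word_equiv.symmetric word_equiv.transitive)
qed

end


section \<open>The isomorphism\<close>

lemma Word_add [simp]: "Word u + Word v = Word (u @ v)"
  by (simp add: plus_fword_def)

lemma letters_zero [simp]: "letters 0 = []"
  by (simp add: zero_fword_def)

lemma letters_add [simp]: "letters (u + v) = letters u @ letters v"
  by (simp add: plus_fword_def)

interpretation free: submonoid_algebra "{w. set (letters w) \<subseteq> X}" for X :: "'x set"
  by standard auto

lemmas free_algebra_operations [simp] = free.operations[folded free_algebra_def]
lemmas free_algebra_closed = free.closed[folded free_algebra_def]
lemmas free_algebra_mem = free.mem_carrier[folded free_algebra_def]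
lemmas free_algebra_ring = free.ring[folded free_algebra_def]

context commuting_solution
begin

abbreviation opposite :: "('k::field, 'x multiset \<Rightarrow>\<^sub>0 'k) module" where
  "opposite \<equiv> braided_op G (sym_algebra X) homogeneous sym_act"

lemma opposite_operations [simp]:
  "carrier opposite = carrier (sym_algebra X)"
  "one opposite = 1" "zero opposite = 0" "add opposite = (+)"
  "smult opposite = (\<lambda>a. Poly_Mapping.map ((*) a))"
  by (simp_all add: braided_op_def)

text \<open>
  The braided-opposite product, summed over monomials rather than homogeneous components.  In this
  form it is visibly bilinear, so identities can be checked on monomials.
\<close>

definition opposite_mult ::
  "('x multiset \<Rightarrow>\<^sub>0 'k::field) \<Rightarrow> ('x multiset \<Rightarrow>\<^sub>0 'k) \<Rightarrow> ('x multiset \<Rightarrow>\<^sub>0 'k)" where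
  "opposite_mult f h = linear_extension (\<lambda>m. sym_act (deg m) h * Poly_Mapping.single m 1) f"

lemma mult_opposite:
  assumes f: "f \<in> carrier (sym_algebra X)" and h: "h \<in> carrier (sym_algebra X)"
  shows "f \<otimes>\<^bsub>opposite\<^esub> h = opposite_mult f h"
proof -
  let ?K = "Poly_Mapping.keys f"
  let ?s = "\<lambda>m. Poly_Mapping.single m (Poly_Mapping.lookup f m)"
  have part: "homogeneous_part f g \<in> carrier (sym_algebra X)" for g
    using f by (auto simp: sym_algebra_mem lookup_homogeneous_part in_keys_iff)
  have closed: "sym_act g h * homogeneous_part f g \<in> carrier (sym_algebra X)" if "g \<in> deg ` ?K" for g
    using that deg_mem[OF f] h part by (auto intro!: sym_algebra_closed sym_act_closed)
  have "f \<otimes>\<^bsub>opposite\<^esub> h =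
      finsum (sym_algebra X) (\<lambda>g. sym_act g h * homogeneous_part f g) (deg ` ?K)"
    by (simp add: braided_op_def components_eq[OF f] homogeneous_part_support)
  also have "\<dots> = (\<Sum>g\<in>deg ` ?K. sym_act g h * homogeneous_part f g)"
    by (rule sym_algebra_finsum[OF finite_imageI[OF finite_keys] closed])
  also have "\<dots> = (\<Sum>g\<in>deg ` ?K. \<Sum>m\<in>{m \<in> ?K. deg m = g}. sym_act (deg m) h * ?s m)"
    unfolding homogeneous_part_eq_sum sum_distrib_left by (intro sum.cong) auto
  also have "\<dots> = (\<Sum>m\<in>?K. sym_act (deg m) h * ?s m)"
    by (rule sum.image_gen[OF finite_keys, symmetric])
  also have "\<dots> = opposite_mult f h"
    unfolding opposite_mult_def linear_extension_def
    by (simp add: scale_single flip: scale_mult_right)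
  finally show ?thesis .
qed

lemma opposite_mult_single:
  "opposite_mult (Poly_Mapping.single m c) (Poly_Mapping.single n d) =
     Poly_Mapping.single (m + image_mset (deg m) n) (c * d)"
  by (simp add: opposite_mult_def mult_single scale_single add.commute)

lemma opposite_mult_add_left: "opposite_mult (f + f') h = opposite_mult f h + opposite_mult f' h"
  by (simp add: opposite_mult_def linear_extension_add)

lemma opposite_mult_add_right: "opposite_mult f (h + h') = opposite_mult f h + opposite_mult f h'"
  by (simp add: opposite_mult_def linear_extension_def sym_act_add distrib_right scale_add_right
      sum.distrib)

lemma opposite_mult_zero [simp]: "opposite_mult 0 h = 0" "opposite_mult f 0 = 0"
  by (simp_all add: opposite_mult_def linear_extension_def)

definition word_map :: "('x fword \<Rightarrow>\<^sub>0 'k::field) \<Rightarrow> ('x multiset \<Rightarrow>\<^sub>0 'k)" where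
  "word_map = linear_extension (\<lambda>w. Poly_Mapping.single (twist (letters w)) 1)"

lemma word_map_single [simp]:
  "word_map (Poly_Mapping.single w c) = Poly_Mapping.single (twist (letters w)) c"
  by (simp add: word_map_def scale_single)

lemma word_map_zero [simp]: "word_map 0 = 0"
  by (simp add: word_map_def)

lemma word_map_add: "word_map (f + h) = word_map f + word_map h"
  by (simp add: word_map_def linear_extension_add)

lemma word_map_diff: "word_map (f - h) = word_map f - word_map h"
  by (simp add: word_map_def linear_extension_diff)

lemma word_map_scale:
  "word_map (Poly_Mapping.map ((*) c) f) = Poly_Mapping.map ((*) c) (word_map f)"
  by (simp add: word_map_def linear_extension_scale)

lemma word_map_closed:
  fixes f :: "'x fword \<Rightarrow>\<^sub>0 'k::field"
  assumes "f \<in> carrier (free_algebra X)"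
  shows "word_map f \<in> carrier (sym_algebra X)"
  unfolding sym_algebra_def sym.mem_carrier word_map_def
proof (rule keys_linear_extension)
  fix w assume "w \<in> Poly_Mapping.keys f"
  with assms have "set (letters w) \<subseteq> X" by (auto simp: free_algebra_mem)
  from twist_mem[OF this]
  show "Poly_Mapping.keys (Poly_Mapping.single (twist (letters w)) (1 :: 'k)) \<subseteq> {m. set_mset m \<subseteq> X}"
    by simp
qed

lemma word_map_mult:
  fixes f h :: "'x fword \<Rightarrow>\<^sub>0 'k::field"
  assumes f: "f \<in> carrier (free_algebra X)" and h: "h \<in> carrier (free_algebra X)"
  shows "word_map (f * h) = opposite_mult (word_map f) (word_map h)"
  using f unfolding free_algebra_mem
proof (induction f rule: monomial_induct)
  case (single v c)
  show ?case
    using h unfolding free_algebra_mem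
  proof (induction h rule: monomial_induct)
    case (single w d)
    then show ?case
      using \<open>v \<in> _\<close> by (simp add: mult_single opposite_mult_single twist_append)
  qed (simp_all add: distrib_left word_map_add opposite_mult_add_right)
qed (simp_all add: distrib_right word_map_add opposite_mult_add_left)

definition normal_word :: "'x multiset \<Rightarrow> 'x fword" where
  "normal_word m = Word (SOME w. set w \<subseteq> X \<and> twist w = m)"

lemma normal_word:
  assumes "set_mset m \<subseteq> X"
  shows "set (letters (normal_word m)) \<subseteq> X" "twist (letters (normal_word m)) = m"
  using someI_ex[OF twist_surj[OF assms]] by (simp_all add: normal_word_def)

definition normal_lift :: "('x multiset \<Rightarrow>\<^sub>0 'k::field) \<Rightarrow> ('x fword \<Rightarrow>\<^sub>0 'k)" where
  "normal_lift = linear_extension (\<lambda>m. Poly_Mapping.single (normal_word m) 1)"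

lemma normal_lift_closed:
  fixes f :: "'x multiset \<Rightarrow>\<^sub>0 'k::field"
  assumes "f \<in> carrier (sym_algebra X)"
  shows "normal_lift f \<in> carrier (free_algebra X)"
  unfolding free_algebra_mem normal_lift_def
proof (rule keys_linear_extension)
  fix m assume "m \<in> Poly_Mapping.keys f"
  with assms have "set_mset m \<subseteq> X" by (auto simp: sym_algebra_mem)
  from normal_word(1)[OF this]
  show "Poly_Mapping.keys (Poly_Mapping.single (normal_word m) (1 :: 'k)) \<subseteq> {w. set (letters w) \<subseteq> X}"
    by simp
qed

lemma word_map_normal_lift:
  assumes "f \<in> carrier (sym_algebra X)"
  shows "word_map (normal_lift f) = f"
  using assms unfolding sym_algebra_def sym.mem_carrier
proof (induction f rule: monomial_induct)
  case (single m c)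
  then show ?case by (simp add: normal_lift_def scale_single normal_word)
qed (simp_all add: normal_lift_def linear_extension_add word_map_add)

lemma word_map_image: "word_map ` carrier (free_algebra X) = carrier (sym_algebra X)"
  using word_map_closed word_map_normal_lift normal_lift_closed by (metis image_eqI subsetI subset_antisym image_subsetI)

text \<open>
  The ring axioms of the braided-opposite algebra need no separate verification: it is the image
  of a ring under a multiplicative and additive map.
\<close>

lemma word_map_ring_hom_ring:
  "ring_hom_ring (free_algebra X :: ('k::field, _) module) opposite word_map"
proof -
  have hom: "word_map \<in> ring_hom (free_algebra X :: ('k::field, _) module) opposite"
  proof (rule ring_hom_memI)
    show "word_map \<one>\<^bsub>free_algebra X\<^esub> = \<one>\<^bsub>opposite\<^esub>"
      by (simp flip: single_one)
  qed (simp_all add: word_map_closed word_map_add word_map_mult mult_opposite)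
  have "opposite\<lparr>carrier := word_map ` carrier (free_algebra X :: ('k::field, _) module),
      zero := word_map \<zero>\<^bsub>free_algebra X\<^esub>\<rparr> = (opposite :: ('k, _) module)"
    by (simp add: word_map_image braided_op_def)
  then have "ring (opposite :: ('k, _) module)"
    using ring.ring_hom_imp_img_ring[OF free_algebra_ring hom] by simp
  then show ?thesis
    using hom by (intro ring_hom_ringI2 free_algebra_ring)
qed

abbreviation relation_ideal :: "('x fword \<Rightarrow>\<^sub>0 'k::field) set" where
  "relation_ideal \<equiv> Idl\<^bsub>free_algebra X\<^esub> (quad_relators X r)"

lemma quad_relators_eq:
  "quad_relators X r = {Poly_Mapping.single (Word [x, y]) 1 - Poly_Mapping.single (Word [z, t]) 1
     | x y z t. x \<in> X \<and> y \<in> X \<and> r (x, y) = (z, t)}"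
  by (simp add: quad_relators_def free_var_def mult_single)

lemma quad_relators_closed:
  "quad_relators X r \<subseteq> carrier (free_algebra X :: ('k::field, _) module)"
proof -
  have "Poly_Mapping.single (Word [x, y]) 1 - Poly_Mapping.single (Word [z, t]) 1
      \<in> carrier (free_algebra X :: ('k, _) module)"
    if xy: "x \<in> X" "y \<in> X" and r: "r (x, y) = (z, t)" for x y z t
  proof -
    have "{x, y, z, t} \<subseteq> X" using xy r_eq(1,2)[OF xy r] by simp
    then have "Poly_Mapping.single (Word [x, y]) 1 + - Poly_Mapping.single (Word [z, t]) 1
        \<in> carrier (free_algebra X :: ('k, _) module)"
      by (intro free_algebra_closed) simp_all
    then show ?thesis by simp
  qed
  then show ?thesis unfolding quad_relators_eq by blast
qed

lemma relation_ideal_closed: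
  fixes f h :: "'x fword \<Rightarrow>\<^sub>0 'k::field"
  shows "0 \<in> (relation_ideal :: ('x fword \<Rightarrow>\<^sub>0 'k) set)"
    and "\<lbrakk>f \<in> relation_ideal; h \<in> relation_ideal\<rbrakk> \<Longrightarrow> f + h \<in> relation_ideal"
    and "\<lbrakk>f \<in> relation_ideal; h \<in> carrier (free_algebra X)\<rbrakk> \<Longrightarrow> h * f \<in> relation_ideal"
    and "\<lbrakk>f \<in> relation_ideal; h \<in> carrier (free_algebra X)\<rbrakk> \<Longrightarrow> f * h \<in> relation_ideal"
    and "f \<in> relation_ideal \<Longrightarrow> Poly_Mapping.map ((*) c) f \<in> relation_ideal"
proof -
  interpret F: ring "free_algebra X :: ('k, _) module" by (rule free_algebra_ring)
  interpret I: ideal relation_ideal "free_algebra X :: ('k, _) module"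
    by (rule F.genideal_ideal[OF quad_relators_closed])
  show "0 \<in> (relation_ideal :: ('x fword \<Rightarrow>\<^sub>0 'k) set)"
    using I.zero_closed by simp
  show "f + h \<in> relation_ideal" if "f \<in> relation_ideal" "h \<in> relation_ideal"
    using I.a_closed[OF that] by simp
  show l: "h * f \<in> relation_ideal"
    if "f \<in> relation_ideal" "h \<in> carrier (free_algebra X)" for f h :: "'x fword \<Rightarrow>\<^sub>0 'k"
    using I.I_l_closed[OF that] by simp
  show "f * h \<in> relation_ideal" if "f \<in> relation_ideal" "h \<in> carrier (free_algebra X)"
    using I.I_r_closed[OF that] by simp
  show "Poly_Mapping.map ((*) c) f \<in> relation_ideal" if "f \<in> relation_ideal"
    unfolding mult_map_scale_conv_mult by (rule l[OF that]) (auto intro: free_algebra_closed)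
qed

lemma word_equiv_diff_in_ideal:
  "\<lbrakk>word_equiv X r v w; set v \<subseteq> X\<rbrakk> \<Longrightarrow>
    Poly_Mapping.single (Word v) 1 - Poly_Mapping.single (Word w) 1 \<in>
      (relation_ideal :: ('x fword \<Rightarrow>\<^sub>0 'k::field) set)"
proof (induction rule: word_equiv.induct)
  case (reflexive w)
  then show ?case by (simp add: relation_ideal_closed)
next
  case (relation x y z t w)
  interpret F: ring "free_algebra X :: ('k, _) module" by (rule free_algebra_ring)
  have "Poly_Mapping.single (Word [x, y]) 1 - Poly_Mapping.single (Word [z, t]) 1 \<in>
      (relation_ideal :: ('x fword \<Rightarrow>\<^sub>0 'k) set)"
    using relation F.genideal_self[OF quad_relators_closed] unfolding quad_relators_eq by blast
  moreover have "Poly_Mapping.single (Word w) 1 \<in> carrier (free_algebra X :: ('k, _) module)"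
    using relation by (intro free_algebra_closed) auto
  ultimately have "(Poly_Mapping.single (Word [x, y]) 1 - Poly_Mapping.single (Word [z, t]) 1) *
      Poly_Mapping.single (Word w) 1 \<in> (relation_ideal :: ('x fword \<Rightarrow>\<^sub>0 'k) set)"
    by (rule relation_ideal_closed)
  then show ?case by (simp add: left_diff_distrib mult_single)
next
  case (prefix x v w)
  have "Poly_Mapping.single (Word [x]) 1 \<in> carrier (free_algebra X :: ('k, _) module)"
    using prefix by (intro free_algebra_closed) auto
  with prefix have "Poly_Mapping.single (Word [x]) 1 *
      (Poly_Mapping.single (Word v) 1 - Poly_Mapping.single (Word w) 1) \<in>
      (relation_ideal :: ('x fword \<Rightarrow>\<^sub>0 'k) set)"
    by (intro relation_ideal_closed) auto
  then show ?case by (simp add: right_diff_distrib mult_single)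
next
  case (symmetric v w)
  then have "set v \<subseteq> X" using word_equiv_twist by blast
  from relation_ideal_closed(5)[OF symmetric.IH[OF this], of "- 1"] show ?case
    by (simp add: scale_minus_one)
next
  case (transitive u v w)
  then have "set v \<subseteq> X" using word_equiv_twist by blast
  from relation_ideal_closed(2)[OF transitive.IH(1)[OF transitive.prems] transitive.IH(2)[OF this]]
  show ?case by simp
qed

text \<open>
  Modulo the relations, every word may be replaced by the chosen word with the same monomial.  So
  an element of the kernel is congruent to the lift of its image \<open>0\<close>.
\<close>

lemma diff_normal_lift_in_ideal:
  fixes f :: "'x fword \<Rightarrow>\<^sub>0 'k::field"
  assumes "f \<in> carrier (free_algebra X)"
  shows "f - normal_lift (word_map f) \<in> relation_ideal"
  using assms unfolding free_algebra_mem
proof (induction f rule: monomial_induct)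
  case zero
  show ?case by (simp add: normal_lift_def relation_ideal_closed)
next
  case (single w c)
  let ?n = "normal_word (twist (letters w))"
  have w: "set (letters w) \<subseteq> X" using single by simp
  then have "word_equiv X r (letters w) (letters ?n)"
    by (intro word_equiv_if_twist_eq) (simp_all add: normal_word twist_mem)
  from relation_ideal_closed(5)[OF word_equiv_diff_in_ideal[OF this w], of c]
  have "Poly_Mapping.single w c - Poly_Mapping.single ?n c \<in> relation_ideal"
    by (simp add: mult_map_scale_conv_mult right_diff_distrib mult_single)
  then show ?case by (simp add: normal_lift_def scale_single)
next
  case (add f h)
  have "f + h - normal_lift (word_map (f + h)) =
      (f - normal_lift (word_map f)) + (h - normal_lift (word_map h))"
    by (simp add: normal_lift_def word_map_add linear_extension_add)
  then show ?case by (simp only: relation_ideal_closed(2)[OF add.IH])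
qed

lemma mem_kernel_word_map:
  "f \<in> a_kernel (free_algebra X) opposite word_map \<longleftrightarrow>
     f \<in> carrier (free_algebra X) \<and> word_map f = 0"
  by (simp add: a_kernel_def')

lemma word_map_relator:
  assumes "f \<in> quad_relators X r"
  shows "word_map f = 0"
proof -
  obtain x y z t where xyzt: "x \<in> X" "y \<in> X" "r (x, y) = (z, t)"
    and f_eq: "f = Poly_Mapping.single (Word [x, y]) 1 - Poly_Mapping.single (Word [z, t]) 1"
    using assms unfolding quad_relators_eq by blast
  have "twist [x, y] = twist [z, t]" by (rule twist_swap[OF xyzt]) simp
  then show ?thesis by (simp add: f_eq word_map_diff del: twist.simps)
qed

lemma kernel_word_map:
  "a_kernel (free_algebra X :: ('k::field, _) module) opposite word_map = relation_ideal"
proof (rule subset_antisym)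
  have "quad_relators X r \<subseteq> a_kernel (free_algebra X :: ('k, _) module) opposite word_map"
    using word_map_relator quad_relators_closed unfolding subset_iff mem_kernel_word_map by blast
  then show "relation_ideal \<subseteq> a_kernel (free_algebra X :: ('k, _) module) opposite word_map"
    by (rule ring.genideal_minimal[OF free_algebra_ring
          ring_hom_ring.kernel_is_ideal[OF word_map_ring_hom_ring]])
  have "f \<in> relation_ideal"
    if "f \<in> carrier (free_algebra X)" "word_map f = 0" for f :: "'x fword \<Rightarrow>\<^sub>0 'k"
    using diff_normal_lift_in_ideal[OF that(1)] that(2) by (simp add: normal_lift_def)
  then show "a_kernel (free_algebra X :: ('k, _) module) opposite word_map \<subseteq> relation_ideal"
    unfolding subset_iff mem_kernel_word_map by blast
qed

lemma relation_ideal_coset: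
  "relation_ideal +>\<^bsub>free_algebra X\<^esub> f = (\<lambda>i. i + f) ` relation_ideal"
  by (auto simp: a_r_coset_def')

lemma word_map_coset:
  fixes f :: "'x fword \<Rightarrow>\<^sub>0 'k::field"
  shows "word_map ` (relation_ideal +>\<^bsub>free_algebra X\<^esub> f) = {word_map f}"
proof -
  let ?I = "relation_ideal :: ('x fword \<Rightarrow>\<^sub>0 'k) set"
  have "word_map (i + f) = word_map f" if "i \<in> ?I" for i
    using that unfolding kernel_word_map[symmetric] mem_kernel_word_map by (simp add: word_map_add)
  then have "(\<lambda>i. word_map (i + f)) ` ?I = (\<lambda>i. word_map f) ` ?I"
    by (rule image_cong[OF refl])
  then show ?thesis
    unfolding relation_ideal_coset image_image by (simp only: image_constant[OF relation_ideal_closed(1)])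
qed

text \<open>
  Shows that the union in the scalar multiplication of \<^const>\<open>quotient_algebra\<close> is a single coset.
\<close>

lemma scale_coset:
  fixes f :: "'x fword \<Rightarrow>\<^sub>0 'k::field"
  assumes f: "f \<in> carrier (free_algebra X)"
  shows "(\<Union>h\<in>relation_ideal +>\<^bsub>free_algebra X\<^esub> f.
            relation_ideal +>\<^bsub>free_algebra X\<^esub> Poly_Mapping.map ((*) c) h) =
         relation_ideal +>\<^bsub>free_algebra X\<^esub> Poly_Mapping.map ((*) c) f"
proof -
  have ideal: "ideal relation_ideal (free_algebra X :: ('k, _) module)"
    by (rule ring.genideal_ideal[OF free_algebra_ring quad_relators_closed])
  have "relation_ideal +>\<^bsub>free_algebra X\<^esub> Poly_Mapping.map ((*) c) h =
      relation_ideal +>\<^bsub>free_algebra X\<^esub> Poly_Mapping.map ((*) c) f"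
    if h: "h \<in> relation_ideal +>\<^bsub>free_algebra X\<^esub> f" for h
  proof -
    obtain i where i: "i \<in> relation_ideal" "h = i + f"
      using h unfolding relation_ideal_coset by (rule imageE)
    have "Poly_Mapping.map ((*) c) h \<in>
        relation_ideal +>\<^bsub>free_algebra X\<^esub> Poly_Mapping.map ((*) c) f"
      unfolding relation_ideal_coset i(2) scale_add_right
      by (rule imageI[OF relation_ideal_closed(5)[OF i(1)]])
    then show ?thesis
      using abelian_group.a_repr_independence[OF ring.is_abelian_group[OF free_algebra_ring] _
          free_algebra_closed(7)[OF f] additive_subgroup.a_subgroup[OF ideal.axioms(1)[OF ideal]]]
      by simp
  qed
  moreover have "f \<in> relation_ideal +>\<^bsub>free_algebra X\<^esub> f"
    unfolding relation_ideal_coset using relation_ideal_closed(1) by (metis add_0 imageI)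
  ultimately show ?thesis by blast
qed

theorem quad_algebra_isomorphic_opposite:
  "algebra_isomorphic (field_ring :: 'k::field ring) (quad_algebra X r) opposite"
proof -
  let ?F = "free_algebra X :: ('k, _) module" and ?I = "relation_ideal :: ('x fword \<Rightarrow>\<^sub>0 'k) set"
  let ?\<psi> = "\<lambda>C :: ('x fword \<Rightarrow>\<^sub>0 'k) set. the_elem (word_map ` C)"
  have "word_map ` carrier ?F = carrier (opposite :: ('k, _) module)"
    unfolding opposite_operations by (rule word_map_image)
  from ring_hom_ring.FactRing_iso_set[OF word_map_ring_hom_ring this]
  have "?\<psi> \<in> ring_iso (?F Quot ?I) opposite"
    unfolding kernel_word_map .
  moreover have "ring_iso (?F Quot ?I) (opposite :: ('k, _) module) =
      ring_iso (quad_algebra X r :: ('k, _) module) opposite"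
    unfolding ring_iso_def ring_hom_def quad_algebra_def quotient_algebra_def by simp
  ultimately have iso: "?\<psi> \<in> ring_iso (quad_algebra X r) opposite" by (simp only:)
  have "?\<psi> (c \<odot>\<^bsub>quad_algebra X r\<^esub> C) = c \<odot>\<^bsub>opposite\<^esub> ?\<psi> C"
    if "C \<in> carrier (quad_algebra X r)" for c C
  proof -
    have "C \<in> carrier (?F Quot ?I)"
      using that by (simp add: quad_algebra_def quotient_algebra_def)
    then obtain f where f: "f \<in> carrier ?F" "C = ?I +>\<^bsub>?F\<^esub> f"
      unfolding FactRing_def A_RCOSETS_def' by auto
    have "c \<odot>\<^bsub>quad_algebra X r\<^esub> C = (\<Union>h\<in>C. ?I +>\<^bsub>?F\<^esub> Poly_Mapping.map ((*) c) h)"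
      by (simp add: quad_algebra_def quotient_algebra_def)
    also have "\<dots> = ?I +>\<^bsub>?F\<^esub> Poly_Mapping.map ((*) c) f"
      unfolding f(2) by (rule scale_coset[OF f(1)])
    finally show ?thesis
      by (simp only: f(2) word_map_coset the_elem_eq word_map_scale opposite_operations)
  qed
  then show ?thesis
    unfolding algebra_isomorphic_def by (intro bexI[OF _ iso] ballI)
qed

end

theorem proposition6p9:
  fixes X :: "'x set" and r :: "'x \<times> 'x \<Rightarrow> 'x \<times> 'x"
  assumes "finite X"
    and "ybe_solution X r"
    and "nondegenerate X r"
    and "square_free X r"
    and "involutive X r"
    and "multipermutation_level_2 X r"
  shows "crossed_module_algebra (field_ring :: 'k::field ring) (perm_group X r)
           (sym_algebra X) (sym_homogeneous X r) sym_act \<and>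
         algebra_isomorphic (field_ring :: 'k ring)
           (quad_algebra X r)
           (braided_op (perm_group X r) (sym_algebra X) (sym_homogeneous X r) sym_act)"
proof -
  interpret commuting_solution X r
    using assms by (intro commuting_solution_of_level_2)
  show ?thesis
    using crossed_module_algebra_sym_algebra quad_algebra_isomorphic_opposite by blast
qed

end
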